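(* Let $\tau:=(\sqrt5-1)/2$, let $b_0(z):=\dfrac{\tau z}{1-\tau^2z}$, let $w_n:=1-4^{-n}$ for $n\ge1$, let $B$ be the Blaschke product with (simple) zeros at the points $w_n$ $(n\ge1)$, and let $b:=b_0B^2$. Let $a$ be the outer function such that $(b,a)$ is a pair, and let $\phi:=b/a$, with Taylor expansion $\phi(z)=\sum_{j\ge0}\hat\phi(j)z^j$ on $\mathbb{D}$. Let \[ f(z):=\sum_{n\ge1}\frac{2^{-n}}{1-w_nz}=\sum_{j\ge0}\hat f(j)z^j\qquad(z\in\mathbb{D}). \] Then the series $\sum_{j\ge0}\hat f(j)\,\overline{\hat\phi(j)}$ diverges.
   Context: $\mathbb{D}$ is the open unit disk and $\mathbb{T}$ the unit circle. A function $b\in H^\infty$ with $\|b\|_{H^\infty}\le1$ is non-extreme (not an extreme point of the closed unit ball of $H^\infty$) if and only if $\log(1-|b|^2)\in L^1(\mathbb{T})$; the function $b$ in the claim is non-extreme. If $b$ is non-extreme, there is a unique outer function $a$ with $a(0)>0$ and $|a|^2+|b|^2=1$ a.e. on $\mathbb{T}$, and $(b,a)$ is then called a pair. The Blaschke product is $B(z)=\prod_{n\ge1}\frac{w_n-z}{1-w_nz}$. *)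

theory Defs
  imports "HOL-Complex_Analysis.Complex_Analysis"
begin

text \<open>
  Functions on the unit disk are total functions \<open>complex \<Rightarrow> complex\<close> of which only the
  restriction to \<open>ball 0 1\<close> matters. The unit circle is parametrised by \<open>cis t\<close> for
  \<open>t \<in> {0..2*pi}\<close>.
\<close>

definition Hinf_unit_ball :: "(complex \<Rightarrow> complex) set" where
  "Hinf_unit_ball =
     {g. g holomorphic_on ball 0 1 \<and> (\<forall>z\<in>ball 0 1. norm (g z) \<le> 1)}"

text \<open>
  The library's \<open>extreme_point_of\<close> needs a real vector space of points, which the type
  \<open>complex \<Rightarrow> complex\<close> is not. The definition is therefore spelled out, with equality of
  functions replaced by equality on the disk.
\<close>

definition extreme_Hinf :: "(complex \<Rightarrow> complex) \<Rightarrow> bool" where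
  "extreme_Hinf b \<longleftrightarrow>
     b \<in> Hinf_unit_ball \<and>
     (\<forall>g\<in>Hinf_unit_ball. \<forall>h\<in>Hinf_unit_ball. \<forall>s::real.
        0 < s \<and> s < 1 \<and>
        (\<forall>z\<in>ball 0 1. b z = of_real (1 - s) * g z + of_real s * h z) \<longrightarrow>
        (\<forall>z\<in>ball 0 1. g z = h z))"

definition non_extreme_Hinf :: "(complex \<Rightarrow> complex) \<Rightarrow> bool" where
  "non_extreme_Hinf b \<longleftrightarrow> b \<in> Hinf_unit_ball \<and> \<not> extreme_Hinf b"

definition radial_limit :: "(complex \<Rightarrow> complex) \<Rightarrow> real \<Rightarrow> complex \<Rightarrow> bool" where
  "radial_limit g t l \<longleftrightarrow> ((\<lambda>r::real. g (of_real r * cis t)) \<longlongrightarrow> l) (at_left 1)"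

text \<open>
  Here \<open>k\<close> plays the role of the logarithm of the prescribed boundary modulus. Working with
  \<open>k\<close> directly avoids Isabelle's convention \<open>ln 0 = 0\<close>.
\<close>

definition outer_function :: "(complex \<Rightarrow> complex) \<Rightarrow> bool" where
  "outer_function g \<longleftrightarrow>
     (\<exists>(c::complex) (k::real \<Rightarrow> real).
        norm c = 1 \<and> k absolutely_integrable_on {0..2*pi} \<and>
        (\<forall>z\<in>ball 0 1. g z =
           c * exp (of_real (1 / (2*pi)) *
                    integral {0..2*pi} (\<lambda>t. (cis t + z) / (cis t - z) * of_real (k t)))))"

definition is_pair :: "(complex \<Rightarrow> complex) \<Rightarrow> (complex \<Rightarrow> complex) \<Rightarrow> bool" where
  "is_pair b a \<longleftrightarrow>
     non_extreme_Hinf b \<and> outer_function a \<and> a 0 \<in> \<real> \<and> Re (a 0) > 0 \<and>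
     (AE t in lebesgue_on {0..2*pi}.
        \<exists>\<alpha> \<beta>. radial_limit a t \<alpha> \<and> radial_limit b t \<beta> \<and> (norm \<alpha>)\<^sup>2 + (norm \<beta>)\<^sup>2 = 1)"

definition tau :: real where
  "tau = (sqrt 5 - 1) / 2"

definition ex_b0 :: "complex \<Rightarrow> complex" where
  "ex_b0 z = of_real tau * z / (1 - (of_real tau)\<^sup>2 * z)"

text \<open>
  The zeros are indexed by \<open>n \<ge> 1\<close>. Library series and products start at 0, hence the
  shift \<open>Suc n\<close> below. As \<open>ex_w n\<close> is positive for \<open>n \<ge> 1\<close>, the Blaschke factors need no
  unimodular normalisation.
\<close>

definition ex_w :: "nat \<Rightarrow> real" where
  "ex_w n = 1 - 1 / 4 ^ n"

definition ex_B :: "complex \<Rightarrow> complex" where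
  "ex_B z = (\<Prod>n. (of_real (ex_w (Suc n)) - z) / (1 - of_real (ex_w (Suc n)) * z))"

definition ex_b :: "complex \<Rightarrow> complex" where
  "ex_b z = ex_b0 z * (ex_B z)\<^sup>2"

definition ex_f :: "complex \<Rightarrow> complex" where
  "ex_f z = (\<Sum>n. (1 / 2 ^ Suc n) / (1 - of_real (ex_w (Suc n)) * z))"

definition taylor_coeff :: "(complex \<Rightarrow> complex) \<Rightarrow> nat \<Rightarrow> complex" where
  "taylor_coeff g j = fps_nth (fps_expansion g 0) j"

end

(*
  On the unit circle 1 - |b0|^2 = |a0|^2 with a0(z) = tau (1 - z) / (1 - tau^2 z), and |B| = 1 away
  from the point 1. An outer function is determined by its boundary modulus, because the Poisson integrals of
  an integrable function converge to it in L^1; hence a = a0 and phi(z) = z B(z)^2 / (1 - z). If the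
  series converged, its Abel means, which are the sums over n of 2^-n phi(r w_n), would be bounded for
  0 < r < 1. All these terms are nonnegative, because B is real on the real axis. If r is such that
  r w_N = 1 - 2 * 4^-N, a point whose hyperbolic distance to the zeros is bounded below independently of N,
  then |B(r w_N)| >= 1/27, and the N-th term is at least a constant times 2^N.
*)
theory Submission
  imports Defs
begin

subsection \<open>The Schwarz and Poisson formulas\<close>

text \<open>The definition of a pair gives \<open>a\<close> only through an unknown integrable
  exponent in its Schwarz integral and through radial limits that exist almost everywhere. The
  limits have to be identified with the exponent. Since their existence is part of the hypothesis,
  L1 convergence of the Poisson integrals along one sequence of radii, combined with Fatou's lemma,
  settles this. The number \<open>tau\<close> is the reciprocal of the golden ratio. The relation
  \<open>tau\<^sup>2 = 1 - tau\<close> makes |b0| equal to 1 at the point 1, and so puts a pole of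
  the unperturbed quotient b0/a0 there. The points w_n accumulate at 1 and are zeros of phi, so at r
  = 1 every term 2^-n phi(r w_n) is zero. The growth can be seen only at radii r < 1 that depend on
  N. The distances 1 - w_n shrink by the factor 4 and the weights by the factor 2, which leaves the
  factor 2^N.\<close>

lemma mean_value_circle:
  assumes "continuous_on (cball 0 1) G" "G holomorphic_on ball 0 1" "z \<in> ball 0 1"
  shows "((\<lambda>t. G (cis t) * (cis t / (cis t - z))) has_integral 2 * of_real pi * G z) {0..2*pi}"
proof -
  have "((\<lambda>u. G u / (u - z)) has_contour_integral (2 * of_real pi * \<i> * G z))
      (part_circlepath 0 1 0 (2 * pi))"
    using Cauchy_integral_circlepath[of 0 1 G z] assms by (simp add: circlepath_def)
  then have "((\<lambda>t. G (cis t) / (cis t - z) * \<i> * cis t) has_integral 2 * of_real pi * \<i> * G z) {0..2*pi}"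
    by (subst (asm) has_contour_integral_part_circlepath_iff) auto
  from has_integral_mult_right[OF this, of "-\<i>"] show ?thesis
    by (simp add: mult_ac)
qed

lemma cis_ne_of_disk: "z \<in> ball 0 1 \<Longrightarrow> cis t \<noteq> z"
  using norm_cis[of t] by auto

text \<open>
  The Schwarz kernel is \<open>2 * \<zeta> / (\<zeta> - z) - 1\<close>, and on the unit circle its conjugate is the boundary
  value of a function holomorphic in \<open>\<zeta>\<close>, so both \<open>G\<close> and \<open>cnj G\<close> integrate by the mean value property.
\<close>
lemma Schwarz_formula:
  assumes G: "continuous_on (cball 0 1) G" "G holomorphic_on ball 0 1" and z: "z \<in> ball 0 1"
  shows "((\<lambda>t. (cis t + z) / (cis t - z) * of_real (Re (G (cis t)))) has_integral
           2 * of_real pi * (G z - \<i> * of_real (Im (G 0)))) {0..2*pi}"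
proof -
  have I1: "((\<lambda>t. G (cis t) * (cis t / (cis t - z))) has_integral 2 * of_real pi * G z) {0..2*pi}"
    by (rule mean_value_circle) (use assms in auto)
  have I0: "((\<lambda>t. G (cis t) * (cis t / (cis t - 0))) has_integral 2 * of_real pi * G 0) {0..2*pi}"
    by (rule mean_value_circle) (use assms in auto)
  define H where "H = (\<lambda>u. G u * ((1 + cnj z * u) / (1 - cnj z * u)))"
  have nz: "1 - cnj z * u \<noteq> 0" if "norm u \<le> 1" for u
  proof -
    have "norm (cnj z * u) \<le> norm z * 1" using that by (simp add: norm_mult mult_left_le)
    also have "\<dots> < 1" using z by simp
    finally show ?thesis by auto
  qed
  have "((\<lambda>t. H (cis t) * (cis t / (cis t - 0))) has_integral 2 * of_real pi * H 0) {0..2*pi}"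
    by (rule mean_value_circle) (use assms nz in \<open>auto simp: H_def intro!: continuous_intros holomorphic_intros\<close>)
  then have I2: "((\<lambda>t. cnj (H (cis t))) has_integral cnj (2 * of_real pi * G 0)) {0..2*pi}"
    using has_integral_linear[OF _ bounded_linear_cnj] by (force simp: H_def o_def)
  have "((\<lambda>t. (2 * (G (cis t) * (cis t / (cis t - z))) - G (cis t) * (cis t / (cis t - 0)) + cnj (H (cis t))) / 2)
      has_integral (2 * (2 * of_real pi * G z) - 2 * of_real pi * G 0 + cnj (2 * of_real pi * G 0)) / 2) {0..2*pi}"
    by (intro has_integral_divide has_integral_add has_integral_diff has_integral_mult_right I0 I1 I2)
  moreover have "(2 * (G (cis t) * (cis t / (cis t - z))) - G (cis t) * (cis t / (cis t - 0)) + cnj (H (cis t))) / 2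
      = (cis t + z) / (cis t - z) * of_real (Re (G (cis t)))" for t
  proof -
    have a: "cis t - z \<noteq> 0" using cis_ne_of_disk[OF z, of t] by auto
    have "cnj ((1 + cnj z * cis t) / (1 - cnj z * cis t)) = (1 + z * cis (-t)) / (1 - z * cis (-t))"
      by (simp add: cis_cnj)
    also have "\<dots> = (cis t * (1 + z * cis (-t))) / (cis t * (1 - z * cis (-t)))"
      by simp
    also have "\<dots> = (cis t + z) / (cis t - z)"
      by (simp add: algebra_simps cis_mult)
    finally have b: "cnj (H (cis t)) = cnj (G (cis t)) * ((cis t + z) / (cis t - z))"
      by (simp only: H_def complex_cnj_mult)
    have c: "2 * (G (cis t) * (cis t / (cis t - z))) - G (cis t) * (cis t / (cis t - 0))
       = G (cis t) * ((cis t + z) / (cis t - z))"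
      using a by (simp add: field_simps)
    have "complex_of_real (Re (G (cis t))) = (G (cis t) + cnj (G (cis t))) / 2"
      by (simp add: complex_add_cnj)
    then show ?thesis unfolding b c by (simp add: algebra_simps add_divide_distrib)
  qed
  \<comment> \<open>The terms - G 0 + cnj (G 0) leave - 2 i Im (G 0): the real part of
    \<open>G\<close> on the circle determines \<open>G\<close> only up to an imaginary
    constant.\<close>
  moreover have "(2 * (2 * of_real pi * G z) - 2 * of_real pi * G 0 + cnj (2 * of_real pi * G 0)) / 2 = 2 * of_real pi * (G z - \<i> * of_real (Im (G 0)))"
    by (simp add: complex_eq_iff field_simps)
  ultimately show ?thesis by (simp only:)
qed

definition poisson_kernel :: "complex \<Rightarrow> real \<Rightarrow> real" where
  "poisson_kernel z t = Re ((cis t + z) / (cis t - z))"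

lemma poisson_kernel_eq:
  assumes "z \<in> ball 0 1"
  shows "poisson_kernel z t = (1 - (norm z)\<^sup>2) / (norm (cis t - z))\<^sup>2"
proof -
  have "Re ((cis t + z) / (cis t - z)) = Re ((cis t + z) * cnj (cis t - z)) / (norm (cis t - z))\<^sup>2"
    by (simp add: Re_complex_div_gt_0 complex_div_cnj[of "cis t + z"] Re_divide_of_real)
  also have "Re ((cis t + z) * cnj (cis t - z)) = (norm (cis t))\<^sup>2 - (norm z)\<^sup>2"
    by (simp only: cmod_power2) (simp add: algebra_simps power2_eq_square)
  finally show ?thesis by (simp add: poisson_kernel_def)
qed

lemma poisson_kernel_pos: "z \<in> ball 0 1 \<Longrightarrow> poisson_kernel z t > 0"
  using cis_ne_of_disk[of z t]
  by (auto simp: poisson_kernel_eq abs_square_less_1 intro!: divide_pos_pos)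

lemma poisson_kernel_le:
  assumes "z \<in> ball 0 1"
  shows "poisson_kernel z t \<le> 1 / (1 - norm z)\<^sup>2"
proof -
  have "(1 - norm z) \<le> norm (cis t - z)"
    using norm_triangle_ineq2[of "cis t" z] by simp
  then show ?thesis unfolding poisson_kernel_eq[OF assms] using assms
    by (intro frac_le) (auto intro!: power_mono)
qed

text \<open>On a circle of radius \<open>r\<close> the kernel depends only on the cosine of
  \<open>s - t\<close>. This symmetry allows integration over the point of evaluation to be replaced
  by integration over the boundary variable.\<close>

lemma poisson_kernel_swap:
  assumes "0 \<le> r" "r < 1"
  shows "poisson_kernel (of_real r * cis t) s = poisson_kernel (of_real r * cis s) t"
proof -
  have "(norm (cis s - of_real r * cis t))\<^sup>2 = (norm (cis t - of_real r * cis s))\<^sup>2"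
    by (simp add: cmod_power2 power2_diff power_mult_distrib sin_squared_eq algebra_simps)
  then show ?thesis using assms by (simp add: poisson_kernel_eq norm_mult)
qed

lemma Poisson_formula:
  assumes "continuous_on (cball 0 1) G" "G holomorphic_on ball 0 1" "z \<in> ball 0 1"
  shows "((\<lambda>t. poisson_kernel z t * Re (G (cis t))) has_integral 2 * pi * Re (G z)) {0..2*pi}"
proof -
  have "Re ((cis t + z) / (cis t - z) * of_real (Re (G (cis t)))) = poisson_kernel z t * Re (G (cis t))" for t
    by (simp add: poisson_kernel_def del: times_divide_eq_left)
  then show ?thesis
    using has_integral_Re[OF Schwarz_formula[OF assms]] by simp
qed

lemma continuous_on_poisson_kernel [continuous_intros]:
  assumes "continuous_on A f" "continuous_on A g" "\<And>x. x \<in> A \<Longrightarrow> f x \<in> ball 0 1"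
  shows "continuous_on A (\<lambda>x. poisson_kernel (f x) (g x))"
  unfolding poisson_kernel_def using assms cis_ne_of_disk
  by (intro continuous_intros) auto

text \<open>Borel rather than Lebesgue sets, so that joint measurability of the kernel and the
  product measure come directly. Lebesgue measurable data are replaced by Borel representatives in
  \<open>outer_function_borel_exponent\<close>. The endpoints describe the same point of the circle
  and form a null set.\<close>

abbreviation circle_measure :: "real measure" where
  "circle_measure \<equiv> restrict_space lborel {0..2*pi}"

definition poisson_integral :: "(real \<Rightarrow> real) \<Rightarrow> complex \<Rightarrow> real" where
  "poisson_integral k z = (\<integral>t. poisson_kernel z t * k t \<partial>circle_measure) / (2 * pi)"

lemma finite_measure_circle: "finite_measure circle_measure"
  by (rule finite_measureI) (simp add: emeasure_restrict_space)

interpretation circle: finite_measure circle_measure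
  by (rule finite_measure_circle)

interpretation circle_pair: pair_sigma_finite circle_measure circle_measure ..

text \<open>A bridge from the Henstock-Kurzweil integral, in which the Cauchy and Poisson formulas
  are stated, to the Lebesgue integral, where Fubini and dominated convergence apply.\<close>

lemma integral_circle_measure_continuous:
  fixes f :: "real \<Rightarrow> real"
  assumes "continuous_on {0..2*pi} f" "(f has_integral I) {0..2*pi}"
  shows "integrable circle_measure f" "(\<integral>t. f t \<partial>circle_measure) = I"
proof -
  have i: "set_integrable lborel {0..2*pi} f"
    unfolding set_integrable_def using assms by (intro borel_integrable_compact) auto
  then show "integrable circle_measure f"
    by (simp add: integrable_restrict_space set_integrable_def)
  have "(\<integral>t. f t \<partial>circle_measure) = (LINT t:{0..2*pi}|lborel. f t)"
    by (simp add: integral_restrict_space set_lebesgue_integral_def)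
  also have "\<dots> = integral {0..2*pi} f"
    using set_borel_integral_eq_integral(2)[OF i] .
  finally show "(\<integral>t. f t \<partial>circle_measure) = I"
    using assms(2) by (simp add: integral_unique)
qed

lemma measurable_cis [measurable]: "cis \<in> borel_measurable borel"
  by (intro borel_measurable_continuous_onI continuous_intros)

lemma measurable_poisson_kernel [measurable (raw)]:
  assumes [measurable]: "f \<in> borel_measurable M" "g \<in> borel_measurable M"
  shows "(\<lambda>x. poisson_kernel (f x) (g x)) \<in> borel_measurable M"
proof -
  have [measurable]: "Re \<in> borel_measurable borel"
    by (intro borel_measurable_continuous_onI continuous_intros)
  show ?thesis unfolding poisson_kernel_def by measurable
qed

lemma measurable_circle_ident [measurable]: "(\<lambda>x. x) \<in> borel_measurable circle_measure"
  by (intro measurable_restrict_space1) simp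

lemma integrable_poisson_kernel_mult:
  assumes "integrable circle_measure k" "z \<in> ball 0 1"
  shows "integrable circle_measure (\<lambda>t. poisson_kernel z t * k t)"
proof (rule Bochner_Integration.integrable_bound)
  show "integrable circle_measure (\<lambda>t. 1 / (1 - norm z)\<^sup>2 * k t)"
    using assms(1) by (rule integrable_mult_right)
  have [measurable]: "k \<in> borel_measurable circle_measure" using assms by auto
  show "(\<lambda>t. poisson_kernel z t * k t) \<in> borel_measurable circle_measure"
    by measurable
  show "AE t in circle_measure. norm (poisson_kernel z t * k t) \<le> norm (1 / (1 - norm z)\<^sup>2 * k t)"
    using poisson_kernel_le[OF assms(2)] poisson_kernel_pos[OF assms(2)]
    by (intro AE_I2) (simp add: abs_mult less_imp_le mult_right_mono
        del: divide_const_simps times_divide_eq_left mult_1_left)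
qed

lemma poisson_integral_diff:
  assumes "integrable circle_measure k" "integrable circle_measure h" "z \<in> ball 0 1"
  shows "poisson_integral (\<lambda>t. k t - h t) z = poisson_integral k z - poisson_integral h z"
  unfolding poisson_integral_def
  using Bochner_Integration.integral_diff[OF assms(1,2)[THEN integrable_poisson_kernel_mult, OF assms(3)]]
  by (simp add: right_diff_distrib diff_divide_distrib)

text \<open>Positivity of the kernel. It serves both for bounds by a constant and for the Korovkin
  comparison.\<close>

lemma abs_poisson_integral_le:
  assumes "integrable circle_measure k" "integrable circle_measure h" "z \<in> ball 0 1"
    "\<And>t. t \<in> {0..2*pi} \<Longrightarrow> \<bar>k t\<bar> \<le> h t"
  shows "\<bar>poisson_integral k z\<bar> \<le> poisson_integral h z"
proof -
  have "\<bar>\<integral>t. poisson_kernel z t * k t \<partial>circle_measure\<bar> \<le> (\<integral>t. poisson_kernel z t * h t \<partial>circle_measure)"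
  proof (rule order_trans[OF integral_abs_bound], rule integral_mono)
    show "\<bar>poisson_kernel z t * k t\<bar> \<le> poisson_kernel z t * h t" if "t \<in> space circle_measure" for t
      using assms(4)[of t] that poisson_kernel_pos[OF assms(3), of t]
      by (simp add: abs_mult mult_left_mono)
  qed (use assms integrable_poisson_kernel_mult in auto)
  then show ?thesis by (simp add: poisson_integral_def divide_right_mono)
qed

lemma poisson_integral_Re:
  assumes "continuous_on (cball 0 1) G" "G holomorphic_on ball 0 1" "z \<in> ball 0 1"
  shows "integrable circle_measure (\<lambda>t. Re (G (cis t)))"
    "poisson_integral (\<lambda>t. Re (G (cis t))) z = Re (G z)"
proof -
  have c: "continuous_on {0..2*pi} (\<lambda>t. Re (G (cis t)))"
    by (intro continuous_on_Re continuous_on_compose2[OF assms(1)] continuous_intros) auto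
  then have c': "continuous_on {0..2*pi} (\<lambda>t. poisson_kernel z t * Re (G (cis t)))"
    using assms(3) by (intro continuous_on_mult[OF _ c] continuous_on_poisson_kernel continuous_intros) auto
  show "integrable circle_measure (\<lambda>t. Re (G (cis t)))"
    using c by (intro integral_circle_measure_continuous(1)[OF c integrable_integral]
        integrable_continuous_real)
  show "poisson_integral (\<lambda>t. Re (G (cis t))) z = Re (G z)"
    using integral_circle_measure_continuous(2)[OF c' Poisson_formula[OF assms]]
    by (simp add: poisson_integral_def)
qed

lemma integral_poisson_kernel:
  assumes "z \<in> ball 0 1"
  shows "(\<integral>\<^sup>+t. ennreal (poisson_kernel z t) \<partial>circle_measure) = ennreal (2 * pi)"
proof -
  have c: "continuous_on {0..2*pi} (\<lambda>t. poisson_kernel z t)"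
    using assms by (intro continuous_intros) auto
  have "((\<lambda>t. poisson_kernel z t) has_integral 2 * pi) {0..2*pi}"
    using Poisson_formula[of "\<lambda>_. 1" z] assms by simp
  from integral_circle_measure_continuous[OF c this] show ?thesis
    using poisson_kernel_pos[OF assms] by (subst nn_integral_eq_integral) (auto simp: less_imp_le)
qed

lemma poisson_integral_const: "z \<in> ball 0 1 \<Longrightarrow> poisson_integral (\<lambda>_. c) z = c"
  using poisson_integral_Re(2)[of "\<lambda>_. of_real c" z] by simp

lemma measurable_poisson_integral [measurable]:
  assumes "integrable circle_measure k"
  shows "(\<lambda>t. poisson_integral k (of_real r * cis t)) \<in> borel_measurable circle_measure"
proof -
  have [measurable]: "k \<in> borel_measurable circle_measure" using assms by auto
  show ?thesis unfolding poisson_integral_def by measurable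
qed

text \<open>Contractivity in L1, uniformly in \<open>r\<close>: after Tonelli and
  \<open>poisson_kernel_swap\<close> the inner integral is the total mass 2 pi of a kernel, which
  cancels the normalisation.\<close>

lemma nn_integral_poisson_integral_le:
  assumes "integrable circle_measure k" "0 \<le> r" "r < 1"
  shows "(\<integral>\<^sup>+t. ennreal \<bar>poisson_integral k (of_real r * cis t)\<bar> \<partial>circle_measure)
      \<le> (\<integral>\<^sup>+t. ennreal \<bar>k t\<bar> \<partial>circle_measure)"
proof -
  have [measurable]: "k \<in> borel_measurable circle_measure" using assms by auto
  have d: "of_real r * cis t \<in> ball 0 1" for t using assms by (simp add: norm_mult)
  have "ennreal \<bar>poisson_integral k (of_real r * cis t)\<bar> \<le>
      (\<integral>\<^sup>+s. ennreal (poisson_kernel (of_real r * cis t) s) * ennreal \<bar>k s\<bar> \<partial>circle_measure) * ennreal (1 / (2*pi))" for t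
  proof -
    have "ennreal \<bar>poisson_integral k (of_real r * cis t)\<bar> =
       ennreal \<bar>\<integral>s. poisson_kernel (of_real r * cis t) s * k s \<partial>circle_measure\<bar> * ennreal (1 / (2*pi))"
      by (simp add: poisson_integral_def ennreal_mult'[symmetric])
    also have "\<dots> \<le> (\<integral>\<^sup>+s. ennreal \<bar>poisson_kernel (of_real r * cis t) s * k s\<bar> \<partial>circle_measure) * ennreal (1 / (2*pi))"
      using integral_norm_bound_ennreal[OF integrable_poisson_kernel_mult[OF assms(1) d[of t]]]
      by (intro mult_right_mono) auto
    also have "\<dots> = (\<integral>\<^sup>+s. ennreal (poisson_kernel (of_real r * cis t) s) * ennreal \<bar>k s\<bar> \<partial>circle_measure) * ennreal (1 / (2*pi))"
      using poisson_kernel_pos[OF d]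
      by (simp add: abs_mult ennreal_mult' less_imp_le)
    finally show ?thesis .
  qed
  then have "(\<integral>\<^sup>+t. ennreal \<bar>poisson_integral k (of_real r * cis t)\<bar> \<partial>circle_measure) \<le>
     (\<integral>\<^sup>+t. (\<integral>\<^sup>+s. ennreal (poisson_kernel (of_real r * cis t) s) * ennreal \<bar>k s\<bar> \<partial>circle_measure) * ennreal (1 / (2*pi)) \<partial>circle_measure)"
    by (intro nn_integral_mono)
  also have "\<dots> = (\<integral>\<^sup>+t. \<integral>\<^sup>+s. ennreal (poisson_kernel (of_real r * cis t) s) * ennreal \<bar>k s\<bar> \<partial>circle_measure \<partial>circle_measure) * ennreal (1 / (2*pi))"
    by (intro nn_integral_multc) measurable
  also have "(\<integral>\<^sup>+t. \<integral>\<^sup>+s. ennreal (poisson_kernel (of_real r * cis t) s) * ennreal \<bar>k s\<bar> \<partial>circle_measure \<partial>circle_measure)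
     = (\<integral>\<^sup>+s. \<integral>\<^sup>+t. ennreal (poisson_kernel (of_real r * cis t) s) * ennreal \<bar>k s\<bar> \<partial>circle_measure \<partial>circle_measure)"
    by (rule circle_pair.Fubini'[symmetric]) measurable
  also have "\<dots> = (\<integral>\<^sup>+s. \<integral>\<^sup>+t. ennreal (poisson_kernel (of_real r * cis s) t) * ennreal \<bar>k s\<bar> \<partial>circle_measure \<partial>circle_measure)"
    by (simp add: poisson_kernel_swap[OF assms(2,3)])
  also have "\<dots> = (\<integral>\<^sup>+s. ennreal (2 * pi) * ennreal \<bar>k s\<bar> \<partial>circle_measure)"
    by (subst nn_integral_multc) (use integral_poisson_kernel[OF d] in auto)
  also have "\<dots> = ennreal (2 * pi) * (\<integral>\<^sup>+s. ennreal \<bar>k s\<bar> \<partial>circle_measure)"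
    by (intro nn_integral_cmult) measurable
  also have "\<dots> * ennreal (1 / (2*pi)) = (\<integral>\<^sup>+s. ennreal \<bar>k s\<bar> \<partial>circle_measure) * (ennreal (2 * pi) * ennreal (1 / (2*pi)))"
    by (simp add: mult_ac)
  also have "ennreal (2 * pi) * ennreal (1 / (2*pi)) = 1"
    by (subst ennreal_mult'[symmetric]) auto
  finally show ?thesis by simp
qed

subsection \<open>Radial limits of Poisson integrals\<close>

text \<open>Interior points are needed because \<open>cis 0 = cis (2*pi)\<close>; for them the
  difference of parameters is a multiple of 2 pi of absolute value below 2 pi.\<close>

lemma cis_eq_iff_interior:
  assumes "t \<in> {0<..<2*pi}" "s \<in> {0..2*pi}" "cis s = cis t"
  shows "s = t"
proof -
  obtain n :: int where n: "s - t = 2 * pi * of_int n"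
    using assms(3) sin_cos_eq_iff[of s t] by (auto simp: complex_eq_iff)
  have "\<bar>s - t\<bar> < 2 * pi" using assms by auto
  then have "\<bar>of_int n :: real\<bar> < 1" unfolding n by (simp add: abs_mult)
  then have "n = 0" by linarith
  then show ?thesis using n by simp
qed

text \<open>Compactness turns injectivity at \<open>t\<close> into a uniform gap: parameters far
  from \<open>t\<close> give points far from \<open>cis t\<close> on the circle.\<close>

lemma cis_separation:
  assumes "t \<in> {0<..<2*pi}" "\<delta> > 0"
  obtains c where "c > 0" "\<And>s. s \<in> {0..2*pi} \<Longrightarrow> \<bar>s - t\<bar> \<ge> \<delta> \<Longrightarrow> (norm (cis s - cis t))\<^sup>2 \<ge> c"
proof -
  define K where "K = {0..2*pi} - ball t \<delta>"
  have K: "compact K" unfolding K_def by (intro compact_diff) auto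
  show ?thesis
  proof (cases "K = {}")
    case True
    then show ?thesis by (intro that[of 1]) (auto simp: K_def dist_real_def abs_minus_commute)
  next
    case False
    have "continuous_on K (\<lambda>s. (norm (cis s - cis t))\<^sup>2)" by (intro continuous_intros)
    then obtain s0 where s0: "s0 \<in> K" "\<And>s. s \<in> K \<Longrightarrow> (norm (cis s0 - cis t))\<^sup>2 \<le> (norm (cis s - cis t))\<^sup>2"
      using continuous_attains_inf[OF K False] by blast
    have "cis s0 \<noteq> cis t" using cis_eq_iff_interior[OF assms(1), of s0] s0(1) assms(2) by (auto simp: K_def)
    then show ?thesis using s0(2)
      by (intro that[of "(norm (cis s0 - cis t))\<^sup>2"]) (auto simp: K_def dist_real_def abs_minus_commute)
  qed
qed

text \<open>
  Korovkin's device: \<open>\<bar>g s - g t\<bar> \<le> \<epsilon> + C * (norm (cis s - cis t))\<^sup>2\<close>, and the Poisson integral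
  of the right-hand side is known exactly.
\<close>
lemma poisson_integral_tendsto_bounded:
  assumes g: "g \<in> borel_measurable circle_measure" and M: "\<And>s. s \<in> {0..2*pi} \<Longrightarrow> \<bar>g s\<bar> \<le> M"
    and t: "t \<in> {0<..<2*pi}" and cont: "isCont g t"
  shows "((\<lambda>r. poisson_integral g (of_real r * cis t)) \<longlongrightarrow> g t) (at_left 1)"
proof (rule tendstoI)
  fix e :: real assume e: "e > 0"
  have [measurable]: "g \<in> borel_measurable circle_measure" by (rule g)
  obtain \<delta> where d: "\<delta> > 0" "\<And>s. \<bar>s - t\<bar> < \<delta> \<Longrightarrow> \<bar>g s - g t\<bar> < e / 2"
    using cont e unfolding continuous_at_real_range by (metis half_gt_zero real_norm_def)
  obtain c where c: "c > 0" "\<And>s. s \<in> {0..2*pi} \<Longrightarrow> \<bar>s - t\<bar> \<ge> \<delta> \<Longrightarrow> (norm (cis s - cis t))\<^sup>2 \<ge> c"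
    using cis_separation[OF t d(1)] by metis
  have M0: "M \<ge> 0" using M[of 0] by auto
  \<comment> \<open>Chosen so that \<open>C * c = 2 * M\<close>, the trivial bound of |g s - g t|,
    which is all that is available away from \<open>t\<close>.\<close>
  define C where "C = 2 * M / c"
  \<comment> \<open>For unimodular u and v, |u - v|^2 = 2 - 2 Re (cnj v * u). So the majorant is the
    real part of an affine function of \<open>cis s\<close>, and the Poisson formula evaluates its
    integral.\<close>
  define G where "G = (\<lambda>u. of_real (e / 2) + of_real C * (2 - 2 * (cnj (cis t) * u)))"
  have nrm: "(norm (cis s - cis t))\<^sup>2 = Re (2 - 2 * (cnj (cis t) * cis s))" for s
    using sin_cos_squared_add[of s] sin_cos_squared_add[of t]
    unfolding cmod_power2 by (simp add: power2_eq_square algebra_simps)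
  have bd: "\<bar>g s - g t\<bar> \<le> Re (G (cis s))" if s: "s \<in> {0..2*pi}" for s
  proof -
    have eq: "Re (G (cis s)) = e / 2 + C * (norm (cis s - cis t))\<^sup>2"
      unfolding nrm G_def by simp
    show ?thesis
    proof (cases "\<bar>s - t\<bar> < \<delta>")
      case True
      have "0 \<le> C * (norm (cis s - cis t))\<^sup>2" using M0 c(1) by (simp add: C_def)
      then show ?thesis using d(2)[OF True] unfolding eq by linarith
    next
      case False
      have "\<bar>g s - g t\<bar> \<le> 2 * M" using M[OF s] M[of t] t by auto
      also have "\<dots> = C * c" using c(1) by (simp add: C_def)
      also have "\<dots> \<le> C * (norm (cis s - cis t))\<^sup>2"
        using c(2)[OF s] False M0 c(1) by (intro mult_left_mono) (auto simp: C_def)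
      finally show ?thesis using e unfolding eq by linarith
    qed
  qed
  have ig: "integrable circle_measure g"
    using M by (intro circle.integrable_const_bound[where B = M]) auto
  have hG: "continuous_on (cball 0 1) G" "G holomorphic_on ball 0 1"
    unfolding G_def by (intro continuous_intros holomorphic_intros)+
  have le: "\<bar>poisson_integral g (of_real r * cis t) - g t\<bar> \<le> e / 2 + C * (2 - 2 * r)" if "0 \<le> r" "r < 1" for r
  proof -
    have z: "of_real r * cis t \<in> ball 0 1" using that by (simp add: norm_mult)
    have "\<bar>poisson_integral g (of_real r * cis t) - g t\<bar> = \<bar>poisson_integral (\<lambda>s. g s - g t) (of_real r * cis t)\<bar>"
      using poisson_integral_diff[OF ig _ z, of "\<lambda>_. g t"] poisson_integral_const[OF z] by simp
    also have "\<dots> \<le> poisson_integral (\<lambda>s. Re (G (cis s))) (of_real r * cis t)"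
      using bd poisson_integral_Re(1)[OF hG z] ig by (intro abs_poisson_integral_le z) auto
    also have "\<dots> = Re (G (of_real r * cis t))"
      by (rule poisson_integral_Re(2)[OF hG z])
    also have "\<dots> = e / 2 + C * (2 - 2 * r)"
    proof -
      have "cnj (cis t) * (of_real r * cis t) = of_real r" by (simp add: cis_cnj cis_mult)
      then show ?thesis unfolding G_def by (simp only:) simp
    qed
    finally show ?thesis .
  qed
  have "((\<lambda>r. e / 2 + C * (2 - 2 * r)) \<longlongrightarrow> e / 2 + C * (2 - 2 * 1)) (at_left 1)"
    by (intro tendsto_intros)
  then have "eventually (\<lambda>r. e / 2 + C * (2 - 2 * r) < e) (at_left 1)"
    using order_tendstoD(2)[of _ _ _ e] e by fastforce
  moreover have "eventually (\<lambda>r::real. r \<in> {0<..<1}) (at_left 1)"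
    by (rule eventually_at_left_real) simp
  ultimately show "eventually (\<lambda>r. dist (poisson_integral g (of_real r * cis t)) (g t) < e) (at_left 1)"
  proof eventually_elim
    case (elim r)
    then show ?case using le[of r] by (auto simp: dist_real_def)
  qed
qed

text \<open>Sequences of radii are used because dominated convergence and Fatou's lemma concern
  sequences. The class is then enlarged in stages, from continuous to bounded to integrable
  functions.\<close>

definition poisson_L1_convergent :: "(real \<Rightarrow> real) \<Rightarrow> bool" where
  "poisson_L1_convergent k \<longleftrightarrow> integrable circle_measure k \<and>
     (\<forall>r. (\<forall>n. 0 \<le> r n \<and> r n < 1) \<longrightarrow> r \<longlonglongrightarrow> 1 \<longrightarrow>
       (\<lambda>n. \<integral>\<^sup>+t. ennreal \<bar>poisson_integral k (of_real (r n) * cis t) - k t\<bar> \<partial>circle_measure) \<longlonglongrightarrow> 0)"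

lemma filterlim_at_left_1:
  fixes r :: "nat \<Rightarrow> real"
  assumes "\<And>n. r n < 1" "r \<longlonglongrightarrow> 1"
  shows "filterlim r (at_left 1) sequentially"
  using assms by (auto simp: filterlim_at less_imp_neq)

lemma AE_circle_interior: "AE t in circle_measure. t \<in> {0<..<2*pi}"
proof -
  have "AE t in lborel. t \<in> {0..2*pi} \<longrightarrow> t \<in> {0<..<2*pi}"
    using AE_lborel_singleton[of "0::real"] AE_lborel_singleton[of "2*pi"]
    by eventually_elim (auto simp: less_le)
  then show ?thesis by (subst AE_restrict_space_iff; (assumption | simp))
qed

text \<open>No periodicity is assumed: \<open>g\<close> may differ at 0 and 2 pi, and pointwise
  convergence may fail there, but it holds at interior points and 2M dominates everywhere.\<close>

lemma poisson_L1_convergent_continuous: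
  fixes g :: "real \<Rightarrow> real"
  assumes cont: "continuous_on UNIV g" and M: "\<And>t. \<bar>g t\<bar> \<le> M"
  shows "poisson_L1_convergent g"
  unfolding poisson_L1_convergent_def
proof (intro conjI allI impI)
  have "g \<in> borel_measurable borel" using cont by (rule borel_measurable_continuous_onI)
  then have g [measurable]: "g \<in> borel_measurable circle_measure"
    by (intro measurable_restrict_space1) simp
  show ig: "integrable circle_measure g"
    using M by (intro circle.integrable_const_bound[where B = M]) auto
  fix r :: "nat \<Rightarrow> real" assume r: "\<forall>n. 0 \<le> r n \<and> r n < 1" "r \<longlonglongrightarrow> 1"
  have [measurable]: "(\<lambda>t. poisson_integral g (of_real (r n) * cis t)) \<in> borel_measurable circle_measure" for n
    by (rule measurable_poisson_integral[OF ig])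
  have fl: "filterlim r (at_left 1) sequentially" using r by (intro filterlim_at_left_1) auto
  have "(\<lambda>n. \<integral>\<^sup>+t. ennreal \<bar>poisson_integral g (of_real (r n) * cis t) - g t\<bar> \<partial>circle_measure)
      \<longlonglongrightarrow> (\<integral>\<^sup>+t. 0 \<partial>circle_measure)"
  proof (rule nn_integral_dominated_convergence[where w = "\<lambda>_. ennreal (2 * M)"])
    show "AE t in circle_measure. ennreal \<bar>poisson_integral g (of_real (r n) * cis t) - g t\<bar> \<le> ennreal (2 * M)" for n
    proof (rule AE_I2, rule ennreal_leI)
      fix t
      have z: "of_real (r n) * cis t \<in> ball 0 1" using r by (simp add: norm_mult)
      have "\<bar>poisson_integral g (of_real (r n) * cis t)\<bar> \<le> M"
        using abs_poisson_integral_le[OF ig _ z, of "\<lambda>_. M"] M poisson_integral_const[OF z] by simp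
      then show "\<bar>poisson_integral g (of_real (r n) * cis t) - g t\<bar> \<le> 2 * M"
        using M[of t] by linarith
    qed
    show "(\<integral>\<^sup>+t. ennreal (2 * M) \<partial>circle_measure) < \<infinity>"
      by (simp add: emeasure_restrict_space ennreal_mult_less_top)
    show "AE t in circle_measure. (\<lambda>n. ennreal \<bar>poisson_integral g (of_real (r n) * cis t) - g t\<bar>) \<longlonglongrightarrow> 0"
      using AE_circle_interior
    proof eventually_elim
      case (elim t)
      have "isCont g t" using cont by (simp add: continuous_on_eq_continuous_at)
      then have "(\<lambda>n. poisson_integral g (of_real (r n) * cis t)) \<longlonglongrightarrow> g t"
        using filterlim_compose[OF poisson_integral_tendsto_bounded[OF g M elim] fl] by simp
      then have "(\<lambda>n. \<bar>poisson_integral g (of_real (r n) * cis t) - g t\<bar>) \<longlonglongrightarrow> 0"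
        by (intro tendsto_rabs_zero) (simp add: LIM_zero)
      then show ?case using tendsto_ennrealI by fastforce
    qed
  qed auto
  then show "(\<lambda>n. \<integral>\<^sup>+t. ennreal \<bar>poisson_integral g (of_real (r n) * cis t) - g t\<bar> \<partial>circle_measure) \<longlonglongrightarrow> 0"
    by simp
qed

text \<open>Write P for the Poisson integral at radius \<open>r n\<close>. In P k - k = (P h - h) +
  P (k - h) - (k - h) the last two terms are bounded by the L1 distance of \<open>k\<close> and
  \<open>h\<close>, uniformly in the radius by contractivity. So \<open>j\<close> can be fixed
  before \<open>n\<close> tends to infinity.\<close>

lemma poisson_L1_convergent_limit:
  assumes k: "integrable circle_measure k" and h: "\<And>j::nat. poisson_L1_convergent (h j)"
    and lim: "(\<lambda>j. \<integral>\<^sup>+t. ennreal \<bar>k t - h j t\<bar> \<partial>circle_measure) \<longlonglongrightarrow> 0"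
  shows "poisson_L1_convergent k"
  unfolding poisson_L1_convergent_def
proof (intro conjI allI impI k)
  fix r :: "nat \<Rightarrow> real" assume r: "\<forall>n. 0 \<le> r n \<and> r n < 1" "r \<longlonglongrightarrow> 1"
  define D where "D k n = (\<integral>\<^sup>+t. ennreal \<bar>poisson_integral k (of_real (r n) * cis t) - k t\<bar> \<partial>circle_measure)" for k n
  define E where "E j = (\<integral>\<^sup>+t. ennreal \<bar>k t - h j t\<bar> \<partial>circle_measure)" for j
  have ih: "integrable circle_measure (h j)" for j using h[of j] by (simp add: poisson_L1_convergent_def)
  have [measurable]: "k \<in> borel_measurable circle_measure" "h j \<in> borel_measurable circle_measure" for j
    using k ih[of j] by auto
  have [measurable]: "(\<lambda>t. poisson_integral k (of_real (r n) * cis t)) \<in> borel_measurable circle_measure"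
    "(\<lambda>t. poisson_integral (h j) (of_real (r n) * cis t)) \<in> borel_measurable circle_measure"
    "(\<lambda>t. poisson_integral (\<lambda>t. k t - h j t) (of_real (r n) * cis t)) \<in> borel_measurable circle_measure" for n j
    using k ih[of j] by (intro measurable_poisson_integral; simp)+
  have le: "D k n \<le> D (h j) n + E j + E j" for n j
  proof -
    have z: "of_real (r n) * cis t \<in> ball 0 1" for t using r by (simp add: norm_mult)
    have "D k n \<le> (\<integral>\<^sup>+t. (ennreal \<bar>poisson_integral (h j) (of_real (r n) * cis t) - h j t\<bar>
        + ennreal \<bar>poisson_integral (\<lambda>t. k t - h j t) (of_real (r n) * cis t)\<bar>) + ennreal \<bar>k t - h j t\<bar> \<partial>circle_measure)"
      unfolding D_def
    proof (rule nn_integral_mono)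
      fix t
      have "\<bar>poisson_integral k (of_real (r n) * cis t) - k t\<bar> \<le>
          \<bar>poisson_integral (h j) (of_real (r n) * cis t) - h j t\<bar> +
          \<bar>poisson_integral (\<lambda>t. k t - h j t) (of_real (r n) * cis t)\<bar> + \<bar>k t - h j t\<bar>"
        using poisson_integral_diff[OF k ih[of j] z[of t]] by simp
      then show "ennreal \<bar>poisson_integral k (of_real (r n) * cis t) - k t\<bar> \<le>
          ennreal \<bar>poisson_integral (h j) (of_real (r n) * cis t) - h j t\<bar> +
          ennreal \<bar>poisson_integral (\<lambda>t. k t - h j t) (of_real (r n) * cis t)\<bar> + ennreal \<bar>k t - h j t\<bar>"
        by (simp add: ennreal_plus[symmetric] del: ennreal_plus)
    qed
    also have "\<dots> = D (h j) n
        + (\<integral>\<^sup>+t. ennreal \<bar>poisson_integral (\<lambda>t. k t - h j t) (of_real (r n) * cis t)\<bar> \<partial>circle_measure) + E j"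
      unfolding D_def E_def by (simp add: nn_integral_add)
    also have "\<dots> \<le> D (h j) n + E j + E j"
      unfolding E_def using r k ih[of j]
      by (intro add_mono order_refl nn_integral_poisson_integral_le) auto
    finally show ?thesis .
  qed
  have Dh: "(\<lambda>n. D (h j) n) \<longlonglongrightarrow> 0" for j
    using h[of j] r unfolding D_def poisson_L1_convergent_def by blast
  have "(\<lambda>n. D k n) \<longlonglongrightarrow> 0"
  proof (rule order_tendstoI)
    fix e :: ennreal assume "0 < e"
    have "((\<lambda>j. E j + E j) \<longlongrightarrow> 0 + 0) sequentially" using lim unfolding E_def by (intro tendsto_add) auto
    then have "eventually (\<lambda>j. E j + E j < e) sequentially" using \<open>0 < e\<close> by (intro order_tendstoD(2)) auto
    then obtain j where j: "E j + E j < e" by (auto simp: eventually_sequentially)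
    have "((\<lambda>n. D (h j) n + (E j + E j)) \<longlongrightarrow> 0 + (E j + E j)) sequentially"
      by (intro tendsto_add tendsto_const Dh)
    then have "eventually (\<lambda>n. D (h j) n + (E j + E j) < e) sequentially"
      using j by (intro order_tendstoD(2)) auto
    then show "eventually (\<lambda>n. D k n < e) sequentially"
      by eventually_elim (use le[of _ j] in \<open>auto simp: add.assoc intro: le_less_trans\<close>)
  qed auto
  then show "(\<lambda>n. \<integral>\<^sup>+t. ennreal \<bar>poisson_integral k (of_real (r n) * cis t) - k t\<bar> \<partial>circle_measure) \<longlonglongrightarrow> 0"
    unfolding D_def .
qed

text \<open>The form in which closure under L1 limits is applied: \<open>w\<close> is constant when
  passing from continuous to bounded functions, and |k| when passing from truncations to
  \<open>k\<close>.\<close>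

lemma poisson_L1_convergent_dominated:
  assumes k: "integrable circle_measure k" and h: "\<And>j::nat. poisson_L1_convergent (h j)"
    and w: "integrable circle_measure w" "\<And>j t. \<bar>k t - h j t\<bar> \<le> w t"
    and lim: "AE t in circle_measure. (\<lambda>j. h j t) \<longlonglongrightarrow> k t"
  shows "poisson_L1_convergent k"
proof (rule poisson_L1_convergent_limit[OF k h])
  have [measurable]: "k \<in> borel_measurable circle_measure" "h j \<in> borel_measurable circle_measure"
    "w \<in> borel_measurable circle_measure" for j
    using k h[of j] w by (auto simp: poisson_L1_convergent_def)
  have "(\<lambda>j. \<integral>\<^sup>+t. ennreal \<bar>k t - h j t\<bar> \<partial>circle_measure) \<longlonglongrightarrow> (\<integral>\<^sup>+t. 0 \<partial>circle_measure)"
  proof (rule nn_integral_dominated_convergence[where w = "\<lambda>t. ennreal (w t)"])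
    show "AE t in circle_measure. ennreal \<bar>k t - h j t\<bar> \<le> ennreal (w t)" for j
      using w by (intro AE_I2 ennreal_leI)
    have "0 \<le> w t" for t using w(2)[of t 0] by linarith
    then show "(\<integral>\<^sup>+t. ennreal (w t) \<partial>circle_measure) < \<infinity>"
      using w(1) by (simp add: nn_integral_eq_integral)
    show "AE t in circle_measure. (\<lambda>j. ennreal \<bar>k t - h j t\<bar>) \<longlonglongrightarrow> 0"
      using lim
    proof eventually_elim
      case (elim t)
      then have "(\<lambda>j. \<bar>k t - h j t\<bar>) \<longlonglongrightarrow> \<bar>k t - k t\<bar>" by (intro tendsto_intros)
      then show ?case using tendsto_ennrealI by fastforce
    qed
  qed auto
  then show "(\<lambda>j. \<integral>\<^sup>+t. ennreal \<bar>k t - h j t\<bar> \<partial>circle_measure) \<longlonglongrightarrow> 0" by simp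
qed

text \<open>Unfolding \<open>measurable_on\<close> yields continuous functions converging to
  \<open>k\<close> off a negligible set. Clipping them to [-M, M] keeps continuity and the limit and
  supplies the domination.\<close>

lemma poisson_L1_convergent_bounded:
  fixes k :: "real \<Rightarrow> real"
  assumes [measurable]: "k \<in> borel_measurable borel" and M: "\<And>t. \<bar>k t\<bar> \<le> M"
  shows "poisson_L1_convergent k"
proof -
  have "k \<in> borel_measurable (lebesgue_on UNIV)" by (simp add: lebesgue_on_UNIV_eq measurable_completion)
  then have "k measurable_on UNIV" by (intro lebesgue_measurable_imp_measurable_on) auto
  then obtain N g where N: "negligible N" "\<And>n::nat. continuous_on UNIV (g n)"
     "\<And>x. x \<notin> N \<Longrightarrow> (\<lambda>n. g n x) \<longlonglongrightarrow> k x"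
    unfolding measurable_on_def by auto
  define h where "h n t = max (-M) (min M (g n t))" for n t
  have M0: "M \<ge> 0" using M[of 0] by auto
  have hM: "\<bar>h n t\<bar> \<le> M" for n t using M0 by (auto simp: h_def)
  show ?thesis
  proof (rule poisson_L1_convergent_dominated[where h = h and w = "\<lambda>_. 2 * M"])
    show "poisson_L1_convergent (h j)" for j
      by (rule poisson_L1_convergent_continuous[OF _ hM])
        (auto simp: h_def[abs_def] intro!: continuous_on_max continuous_on_min N)
    have "k \<in> borel_measurable circle_measure" by (intro measurable_restrict_space1) simp
    then show "integrable circle_measure k"
      using M by (intro circle.integrable_const_bound[where B = M]) auto
    show "\<bar>k t - h j t\<bar> \<le> 2 * M" for j t using M[of t] hM[of j t] by linarith
    have "AE t in lebesgue. t \<notin> N" using N(1) by (simp add: AE_not_in negligible_iff_null_sets)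
    then have "AE t in lborel. t \<notin> N" by (simp add: AE_completion_iff)
    then have "AE t in lborel. (\<lambda>j. h j t) \<longlonglongrightarrow> k t"
    proof eventually_elim
      case (elim t)
      have "(\<lambda>j. h j t) \<longlonglongrightarrow> max (-M) (min M (k t))"
        unfolding h_def by (intro tendsto_intros N(3) elim)
      then show ?case using M[of t] by (simp add: abs_le_iff max_def min_def split: if_splits)
    qed
    then show "AE t in circle_measure. (\<lambda>j. h j t) \<longlonglongrightarrow> k t"
      by (subst AE_restrict_space_iff) (auto elim: eventually_mono)
  qed auto
qed

lemma poisson_L1_convergent_integrable:
  fixes k :: "real \<Rightarrow> real"
  assumes [measurable]: "k \<in> borel_measurable borel" and ik: "integrable circle_measure k"
  shows "poisson_L1_convergent k"
proof (rule poisson_L1_convergent_dominated[OF ik, where h = "\<lambda>j t. max (- real j) (min (real j) (k t))"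
      and w = "\<lambda>t. \<bar>k t\<bar>"])
  show "poisson_L1_convergent (\<lambda>t. max (- real j) (min (real j) (k t)))" for j
    by (rule poisson_L1_convergent_bounded[where M = "real j"]) auto
  show "\<bar>k t - max (- real j) (min (real j) (k t))\<bar> \<le> \<bar>k t\<bar>" for j t by auto
  show "AE t in circle_measure. (\<lambda>j. max (- real j) (min (real j) (k t))) \<longlonglongrightarrow> k t"
  proof (rule AE_I2)
    fix t
    have "eventually (\<lambda>j. max (- real j) (min (real j) (k t)) = k t) sequentially"
      using eventually_ge_at_top[of "nat \<lceil>\<bar>k t\<bar>\<rceil>"] by eventually_elim linarith
    then show "(\<lambda>j. max (- real j) (min (real j) (k t))) \<longlonglongrightarrow> k t"
      by (rule tendsto_eventually)
  qed
qed (use ik in auto)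

text \<open>Where the radial limit exists, \<open>d n t\<close> tends to |\<kappa> t - k t|, while
  the integrals of \<open>d n\<close> tend to 0; Fatou's lemma forces the limit to vanish almost
  everywhere. Measurability is asked only of \<open>d n\<close>, so \<kappa> can be an arbitrary
  function.\<close>

theorem poisson_integral_radial_limit_unique:
  fixes k :: "real \<Rightarrow> real"
  assumes k [measurable]: "k \<in> borel_measurable borel" and ik: "integrable circle_measure k"
    and lim: "AE t in circle_measure. ((\<lambda>r. poisson_integral k (of_real r * cis t)) \<longlongrightarrow> \<kappa> t) (at_left 1)"
  shows "AE t in circle_measure. k t = \<kappa> t"
proof -
  define r :: "nat \<Rightarrow> real" where "r n = 1 - 1 / (real n + 1)" for n
  have r01: "\<forall>n. 0 \<le> r n \<and> r n < 1" by (auto simp: r_def)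
  have r1: "r \<longlonglongrightarrow> 1" unfolding r_def by real_asymp
  have fl: "filterlim r (at_left 1) sequentially" using r01 r1 by (intro filterlim_at_left_1) auto
  define d where "d n t = ennreal \<bar>poisson_integral k (of_real (r n) * cis t) - k t\<bar>" for n t
  have [measurable]: "k \<in> borel_measurable circle_measure" using ik by auto
  have [measurable]: "(\<lambda>t. poisson_integral k (of_real (r n) * cis t)) \<in> borel_measurable circle_measure" for n
    by (rule measurable_poisson_integral[OF ik])
  have [measurable]: "d n \<in> borel_measurable circle_measure" for n unfolding d_def by measurable
  have "(\<lambda>n. \<integral>\<^sup>+t. d n t \<partial>circle_measure) \<longlonglongrightarrow> 0"
    using poisson_L1_convergent_integrable[OF k ik] r01 r1 unfolding poisson_L1_convergent_def d_def by blast
  then have "liminf (\<lambda>n. \<integral>\<^sup>+t. d n t \<partial>circle_measure) = 0"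
    by (intro lim_imp_Liminf) auto
  moreover have "(\<integral>\<^sup>+t. liminf (\<lambda>n. d n t) \<partial>circle_measure) \<le> liminf (\<lambda>n. \<integral>\<^sup>+t. d n t \<partial>circle_measure)"
    by (rule nn_integral_liminf) auto
  ultimately have "(\<integral>\<^sup>+t. liminf (\<lambda>n. d n t) \<partial>circle_measure) = 0" by simp
  then have "AE t in circle_measure. liminf (\<lambda>n. d n t) = 0"
    by (subst (asm) nn_integral_0_iff_AE) auto
  then show ?thesis using lim
  proof eventually_elim
    case (elim t)
    have "(\<lambda>n. poisson_integral k (of_real (r n) * cis t)) \<longlonglongrightarrow> \<kappa> t"
      using filterlim_compose[OF elim(2) fl] .
    then have "(\<lambda>n. d n t) \<longlonglongrightarrow> ennreal \<bar>\<kappa> t - k t\<bar>"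
      unfolding d_def by (intro tendsto_intros)
    then have "liminf (\<lambda>n. d n t) = ennreal \<bar>\<kappa> t - k t\<bar>" by (intro lim_imp_Liminf) auto
    then show ?case using elim(1) by simp
  qed
qed

subsection \<open>The Blaschke product\<close>

lemma ex_w_bounds: "0 \<le> ex_w n" "ex_w n < 1" "n > 0 \<Longrightarrow> 0 < ex_w n"
proof -
  show "0 \<le> ex_w n" "ex_w n < 1" by (simp_all add: ex_w_def)
  assume "n > 0"
  then have "(4::real) ^ 0 < 4 ^ n" by (intro power_strict_increasing) auto
  then show "0 < ex_w n" by (simp add: ex_w_def)
qed

definition blaschke_factor :: "nat \<Rightarrow> complex \<Rightarrow> complex" where
  "blaschke_factor n z = (of_real (ex_w (Suc n)) - z) / (1 - of_real (ex_w (Suc n)) * z)"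

text \<open>The plane without [1, \<infinity>), which contains all poles 1/w_n and their limit 1. It
  includes the disk and the circle without 1, so holomorphy here gives continuity up to the boundary
  as well.\<close>

definition slit_plane :: "complex set" where
  "slit_plane = - {z. z \<in> \<real> \<and> 1 \<le> Re z}"

lemma open_slit_plane: "open slit_plane"
proof -
  have "{z::complex. z \<in> \<real> \<and> 1 \<le> Re z} = {z. Im z = 0} \<inter> {z. 1 \<le> Re z}"
    by (auto simp: complex_is_Real_iff)
  moreover have "closed ({z. Im z = 0} \<inter> {z. 1 \<le> Re z})"
    by (intro closed_Int closed_Collect_eq closed_Collect_le continuous_intros)
  ultimately show ?thesis unfolding slit_plane_def by (metis open_Compl)
qed

lemma slit_plane_denom:
  assumes "z \<in> slit_plane" "0 \<le> w" "w \<le> 1"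
  shows "1 - of_real w * z \<noteq> 0"
proof
  assume "1 - of_real w * z = 0"
  then have e: "of_real w * z = 1" by simp
  then have w: "w > 0" using assms by (cases "w = 0") auto
  have "z = of_real (1 / w)" using e w by (simp add: field_simps)
  moreover have "1 / w \<ge> 1" using w assms by simp
  ultimately show False using assms(1) by (auto simp: slit_plane_def)
qed

lemma ball_subset_slit_plane: "ball 0 1 \<subseteq> slit_plane"
proof
  fix z :: complex assume "z \<in> ball 0 1"
  then have "Re z < 1" using complex_Re_le_cmod[of z] by simp
  then show "z \<in> slit_plane" by (auto simp: slit_plane_def)
qed

lemma blaschke_factor_holomorphic: "blaschke_factor n holomorphic_on slit_plane"
  unfolding blaschke_factor_def
  using slit_plane_denom ex_w_bounds less_imp_le by (intro holomorphic_intros) blast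

text \<open>With w = \<open>ex_w (Suc n)\<close>, a factor minus 1 equals -(1 - w)(1 + z)/(1 - w z).
  The numbers 1 - w are summable, and compactness of K \<times> [0,1] bounds the denominators below
  uniformly; the closed interval includes the limit w = 1.\<close>

lemma blaschke_partial_products_uniform:
  assumes K: "compact K" "K \<subseteq> slit_plane"
  shows "uniform_limit K (\<lambda>N z. \<Prod>n<N. blaschke_factor n z) ex_B sequentially"
    "\<And>z. z \<in> K \<Longrightarrow> convergent_prod (\<lambda>n. blaschke_factor n z)"
proof -
  have "\<exists>d>0. \<forall>z\<in>K. \<forall>w\<in>{0..1}. d \<le> norm (1 - of_real w * z)"
  proof (cases "K = {}")
    case False
    have cont: "continuous_on (K \<times> {0..1::real}) (\<lambda>p. norm (1 - of_real (snd p) * fst p))"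
      by (intro continuous_intros)
    have "compact (K \<times> {0..1::real})" using K by (intro compact_Times) auto
    moreover have "K \<times> {0..1::real} \<noteq> {}" using False by simp
    ultimately obtain p where p: "p \<in> K \<times> {0..1::real}"
       "\<And>q. q \<in> K \<times> {0..1::real} \<Longrightarrow> norm (1 - of_real (snd p) * fst p) \<le> norm (1 - of_real (snd q) * fst q)"
      using continuous_attains_inf[OF _ _ cont] by blast
    show ?thesis
    proof (intro exI conjI ballI)
      show "0 < norm (1 - of_real (snd p) * fst p)"
        using p(1) K(2) slit_plane_denom[of "fst p" "snd p"] by (auto simp: mem_Times_iff subset_iff)
      show "norm (1 - of_real (snd p) * fst p) \<le> norm (1 - of_real w * z)" if "z \<in> K" "w \<in> {0..1}" for z w
        using p(2)[of "(z, w)"] that by simp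
    qed
  next
    case True
    then show ?thesis by (intro exI[of _ 1]) simp
  qed
  then obtain d where d: "d > 0" "\<And>z w. z \<in> K \<Longrightarrow> w \<in> {0..1} \<Longrightarrow> d \<le> norm (1 - of_real w * z)" by metis
  obtain R where R: "\<And>z. z \<in> K \<Longrightarrow> norm (1 + z) \<le> R"
    using compact_imp_bounded[OF compact_continuous_image[OF _ K(1), of "\<lambda>z. 1 + z"]]
    by (auto simp: bounded_iff continuous_intros)
  have bd: "norm (blaschke_factor n z - 1) \<le> R / d * (1 / 4) ^ n" if z: "z \<in> K" for n z
  proof -
    let ?w = "ex_w (Suc n)"
    have dd: "d \<le> norm (1 - of_real ?w * z)" using d(2)[OF z, of ?w] ex_w_bounds[of "Suc n"] by simp
    then have nz: "1 - of_real ?w * z \<noteq> 0" using d(1) by auto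
    have R0: "0 \<le> R" using norm_ge_zero R[OF z] by (rule order_trans)
    have "blaschke_factor n z - 1 = - (of_real (1 - ?w) * (1 + z)) / (1 - of_real ?w * z)"
      using nz by (simp add: blaschke_factor_def field_simps)
    then have "norm (blaschke_factor n z - 1) = (1 - ?w) * norm (1 + z) / norm (1 - of_real ?w * z)"
      using ex_w_bounds(2)[of "Suc n"] by (simp add: norm_divide norm_mult del: of_real_diff)
    also have "\<dots> \<le> (1 - ?w) * R / d"
      using R[OF z] R0 d(1) dd ex_w_bounds(2)[of "Suc n"]
      by (intro frac_le mult_left_mono mult_nonneg_nonneg) auto
    also have "\<dots> \<le> (1 / 4) ^ n * R / d"
      using d(1) R0
      by (intro divide_right_mono mult_right_mono) (auto simp: ex_w_def field_simps)
    finally show ?thesis by (simp add: mult_ac)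
  qed
  have sm: "summable (\<lambda>n. R / d * (1 / 4) ^ n)" by (intro summable_mult summable_geometric) auto
  have "uniformly_convergent_on K (\<lambda>N z. \<Sum>n<N. norm (blaschke_factor n z - 1))"
    by (rule Weierstrass_m_test'[OF _ sm]) (use bd in auto)
  then have uc: "uniformly_convergent_on K (\<lambda>N z. \<Prod>n<N. blaschke_factor n z)"
    using K by (intro uniformly_convergent_on_prod')
      (auto intro: holomorphic_on_imp_continuous_on holomorphic_on_subset[OF blaschke_factor_holomorphic])
  show cp: "convergent_prod (\<lambda>n. blaschke_factor n z)" if "z \<in> K" for z
  proof (rule abs_convergent_prod_imp_convergent_prod, rule summable_imp_abs_convergent_prod)
    show "summable (\<lambda>n. norm (blaschke_factor n z - 1))"
      by (rule summable_comparison_test'[OF sm, of 0]) (use bd that in auto)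
  qed
  obtain l where l: "uniform_limit K (\<lambda>N z. \<Prod>n<N. blaschke_factor n z) l sequentially"
    using uc unfolding uniformly_convergent_on_def by blast
  \<comment> \<open>Uniform convergence yields some limit; pointwise it must be the infinite product
    defining \<open>ex_B\<close>.\<close>
  have "l z = ex_B z" if "z \<in> K" for z
  proof (rule LIMSEQ_unique)
    show "(\<lambda>N. \<Prod>n<N. blaschke_factor n z) \<longlonglongrightarrow> l z" by (rule tendsto_uniform_limitI[OF l that])
    show "(\<lambda>N. \<Prod>n<N. blaschke_factor n z) \<longlonglongrightarrow> ex_B z"
      using convergent_prod_LIMSEQ[OF cp[OF that]] unfolding ex_B_def blaschke_factor_def
      by (subst LIMSEQ_lessThan_iff_atMost)
  qed
  then show "uniform_limit K (\<lambda>N z. \<Prod>n<N. blaschke_factor n z) ex_B sequentially"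
    using uniform_limit_cong'[of K _ _ l ex_B] l by (simp cong: uniform_limit_cong')
qed

lemma ex_B_LIMSEQ:
  assumes "z \<in> slit_plane"
  shows "(\<lambda>N. \<Prod>n<N. blaschke_factor n z) \<longlonglongrightarrow> ex_B z"
  using tendsto_uniform_limitI[OF blaschke_partial_products_uniform(1)[of "{z}"]] assms by auto

lemma ex_B_holomorphic: "ex_B holomorphic_on slit_plane"
proof (rule holomorphic_uniform_sequence[OF open_slit_plane])
  show "(\<lambda>z. \<Prod>n<N. blaschke_factor n z) holomorphic_on slit_plane" for N
    by (intro holomorphic_on_prod blaschke_factor_holomorphic)
  fix z assume "z \<in> slit_plane"
  then obtain d where d: "d > 0" "cball z d \<subseteq> slit_plane"
    using open_slit_plane unfolding open_contains_cball by metis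
  show "\<exists>d>0. cball z d \<subseteq> slit_plane \<and> uniform_limit (cball z d) (\<lambda>N z. \<Prod>n<N. blaschke_factor n z) ex_B sequentially"
    by (rule exI[of _ d]) (use d in \<open>intro conjI blaschke_partial_products_uniform(1) compact_cball\<close>)
qed

lemma cis_in_slit_plane:
  assumes "t \<in> {0<..<2*pi}"
  shows "cis t \<in> slit_plane"
proof -
  have "cos t < 1"
  proof (rule ccontr)
    assume "\<not> cos t < 1"
    then have "cos t = 1" using cos_le_one[of t] by linarith
    then obtain n :: int where n: "t = of_int n * 2 * pi" using cos_one_2pi_int[of t] by blast
    have "0 < of_int n * (2 * pi)" "of_int n * (2 * pi) < 1 * (2 * pi)"
      using assms unfolding n by (simp_all only: mult.assoc greaterThanLessThan_iff) simp_all
    then have "0 < n" "n < 1"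
      by (simp_all only: zero_less_mult_iff mult_less_cancel_right) auto
    then show False by simp
  qed
  then show ?thesis by (auto simp: slit_plane_def)
qed

text \<open>For |u| = 1 and real w, w - u = - u cnj (1 - w u), so each factor is unimodular and the
  limit inherits this. At the point 1 all factors are -1 and the partial products oscillate, hence
  the open interval.\<close>

lemma norm_ex_B_cis:
  assumes "t \<in> {0<..<2*pi}"
  shows "norm (ex_B (cis t)) = 1"
proof -
  have "norm (blaschke_factor n (cis t)) = 1" for n
  proof -
    let ?w = "ex_w (Suc n)"
    have "of_real ?w - cis t = - (cis t * cnj (1 - of_real ?w * cis t))"
      by (simp add: algebra_simps cis_cnj cis_mult)
    then have "norm (of_real ?w - cis t) = norm (1 - of_real ?w * cis t)"
      by (simp only: norm_minus_cancel norm_mult complex_mod_cnj norm_cis mult_1_left)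
    moreover have "1 - of_real ?w * cis t \<noteq> 0"
      using slit_plane_denom[OF cis_in_slit_plane[OF assms]] ex_w_bounds[of "Suc n"] by simp
    ultimately show ?thesis by (simp add: blaschke_factor_def norm_divide)
  qed
  then have "(\<lambda>N. norm (\<Prod>n<N. blaschke_factor n (cis t))) = (\<lambda>N. 1)"
    by (simp add: prod_norm[symmetric])
  moreover have "(\<lambda>N. norm (\<Prod>n<N. blaschke_factor n (cis t))) \<longlonglongrightarrow> norm (ex_B (cis t))"
    by (intro tendsto_norm ex_B_LIMSEQ cis_in_slit_plane assms)
  ultimately show ?thesis
    by (metis LIMSEQ_const_iff)
qed

lemma ex_B_of_real:
  assumes "0 \<le> x" "x < 1"
  shows "ex_B (of_real x) \<in> \<real>"
proof (rule closed_sequentially[OF closed_complex_Reals, rule_format])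
  show "(\<lambda>N. \<Prod>n<N. blaschke_factor n (of_real x)) \<longlonglongrightarrow> ex_B (of_real x)"
    by (rule ex_B_LIMSEQ) (use assms ball_subset_slit_plane in auto)
  show "(\<Prod>n<N. blaschke_factor n (of_real x)) \<in> \<real>" for N
    unfolding blaschke_factor_def by (intro prod_in_Reals) auto
qed

text \<open>The distance to 1 is the geometric mean of those of \<open>ex_w N\<close> and
  \<open>ex_w (Suc N)\<close>, so for N > 0 the point lies midway, on the logarithmic scale, between
  two consecutive zeros.\<close>

definition test_point :: "nat \<Rightarrow> real" where
  "test_point N = 1 - 2 / 4 ^ Suc N"

lemma test_point_bounds: "0 < test_point N" "test_point N < ex_w (Suc N)"
proof -
  have "(4::real) ^ 1 \<le> 4 ^ Suc N" by (intro power_increasing) auto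
  then have "4 \<le> (4::real) ^ Suc N" by simp
  then show "0 < test_point N" "test_point N < ex_w (Suc N)"
    by (simp_all add: test_point_def ex_w_def field_simps del: power_Suc)
qed

text \<open>
  With \<open>\<delta> = 4 ^ -(N+1)\<close> and \<open>\<epsilon> = 4 ^ -(n+1)\<close>, the right-hand side is
  \<open>\<bar>2 * \<delta> - \<epsilon>\<bar> / (2 * \<delta> + \<epsilon>)\<close>.
\<close>
lemma norm_blaschke_factor_test_point:
  "norm (blaschke_factor n (of_real (test_point N))) \<ge>
     \<bar>2 * 4 ^ n - 4 ^ N\<bar> / (2 * 4 ^ n + 4 ^ N :: real)"
proof -
  define p q :: real where "p = 4 ^ n" and "q = 4 ^ N"
  have pq: "p \<ge> 1" "q \<ge> 1" by (auto simp: p_def q_def)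
  define w x where "w = ex_w (Suc n)" and "x = test_point N"
  have w: "w = 1 - 1 / (4 * p)" and x: "x = 1 - 1 / (2 * q)"
    by (simp_all add: w_def x_def p_def q_def ex_w_def test_point_def)
  have "w * x < 1 * 1" using ex_w_bounds[of "Suc n"] test_point_bounds[of N] ex_w_bounds[of "Suc N"]
    unfolding w_def x_def by (intro mult_strict_mono') auto
  then have wx: "1 - w * x > 0" by simp
  have "blaschke_factor n (of_real x) = of_real ((w - x) / (1 - w * x))"
    by (simp add: blaschke_factor_def w_def)
  then have e: "norm (blaschke_factor n (of_real x)) = \<bar>w - x\<bar> / (1 - w * x)"
    using wx by (simp only: norm_of_real abs_divide)
  have "\<bar>2 * p - q\<bar> / (2 * p + q) = (\<bar>2 * p - q\<bar> / (4 * p * q)) / ((2 * p + q) / (4 * p * q))"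
    using pq by simp
  also have "\<bar>2 * p - q\<bar> / (4 * p * q) = \<bar>(2 * p - q) / (4 * p * q)\<bar>" using pq by simp
  also have "(2 * p - q) / (4 * p * q) = w - x" using pq by (simp add: w x field_simps)
  also have "\<bar>w - x\<bar> / ((2 * p + q) / (4 * p * q)) \<le> \<bar>w - x\<bar> / (1 - w * x)"
  proof (rule divide_left_mono)
    \<comment> \<open>The product (1 - w)(1 - x) is dropped from 1 - w x = (1 - w) + (1 - x) - (1 -
      w)(1 - x).\<close>
    show "1 - w * x \<le> (2 * p + q) / (4 * p * q)" using pq by (simp add: w x field_simps)
    show "0 < (2 * p + q) / (4 * p * q) * (1 - w * x)" using pq wx by (intro mult_pos_pos divide_pos_pos) auto
  qed simp
  finally show ?thesis unfolding e[symmetric] by (simp add: p_def q_def x_def)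
qed

lemma sum_geometric_quarter_le: "(\<Sum>j\<in>{1..n}. (1 / 4 :: real) ^ j) \<le> 1 / 3"
proof -
  have "(\<Sum>j\<in>{1..n}. (1 / 4 :: real) ^ j) = 1 / 3 - (1 / 4) ^ n / 3"
    by (induction n) auto
  then show ?thesis by simp
qed

text \<open>The two zeros next to the test point contribute at least 1/3 each. The other factors are
  at least 1 - u_n with the u_n of total sum at most 2/3, so Weierstrass' inequality bounds their
  product by 1/3 from below. The bound is uniform in \<open>m\<close> and survives the
  limit.\<close>

lemma norm_blaschke_partial_product_test_point:
  "norm (\<Prod>n<m. blaschke_factor n (of_real (test_point N))) \<ge> 1 / 27"
proof -
  define c where "c n = \<bar>2 * 4 ^ n - 4 ^ N\<bar> / (2 * 4 ^ n + 4 ^ N :: real)" for n :: nat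
  \<comment> \<open>For N = 0 truncated subtraction makes this {0}, as there is no zero to the left
    of the test point.\<close>
  define S where "S = {N - 1, N}"
  \<comment> \<open>The exact defect 1 - c_n is 2/(2p + 1) with p = 4^(n - N) to the right, and
    2/(8p + 1) with p = 4^(N - 2 - n) to the left. It is rounded up to 1/p and 1/(4p), so both
    geometric series start at 1/4.\<close>
  define u where "u n = (if N < n then (1 / 4 :: real) ^ (n - N) else (1 / 4) ^ (N - 1 - n))" for n
  have c0: "c n \<ge> 0" for n unfolding c_def by (intro divide_nonneg_pos) (auto intro: add_pos_pos)
  have c1: "c n \<le> 1" for n
    unfolding c_def by (subst divide_le_eq_1_pos) (auto intro: add_pos_pos simp: abs_le_iff)
  have cS: "c n \<ge> 1 / 3" if n: "n \<in> S" for n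
  proof -
    consider "n = N" | "N = Suc n" using n unfolding S_def by fastforce
    then show ?thesis
    proof cases
      case 1
      have "c n = (1 * 4 ^ N) / (3 * 4 ^ N :: real)" unfolding c_def 1 by simp
      then show ?thesis by simp
    next
      case 2
      have "c n = (2 * 4 ^ n) / (6 * 4 ^ n :: real)" unfolding c_def 2 by simp
      then show ?thesis by simp
    qed
  qed
  have cu: "1 - u n \<le> c n" if "n \<notin> S" for n
  proof (cases "N < n")
    case True
    then obtain j where j: "n = N + j" "j > 0" by (metis less_imp_add_positive)
    define p q :: real where "p = 4 ^ j" and "q = 4 ^ N"
    have "(4::real) ^ 1 \<le> 4 ^ j" using j by (intro power_increasing) auto
    then have p: "p \<ge> 4" and q: "q > 0" by (auto simp: p_def q_def)
    have "c n = \<bar>q * (2 * p - 1)\<bar> / (q * (2 * p + 1))"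
      unfolding c_def j p_def q_def by (simp add: power_add algebra_simps)
    also have "\<dots> = (2 * p - 1) / (2 * p + 1)" using p q by (simp add: abs_mult)
    finally have c: "c n = (2 * p - 1) / (2 * p + 1)" .
    have un: "u n = 1 / p" using True j by (simp add: u_def p_def power_one_over)
    show ?thesis using p unfolding c un by (simp add: field_simps)
  next
    case False
    then obtain j where j: "N = n + j" by (metis le_Suc_ex not_less)
    with that have "j \<noteq> 0" "j \<noteq> 1" by (auto simp: S_def)
    then obtain i where i: "j = Suc (Suc i)" by (metis One_nat_def not0_implies_Suc)
    define p q :: real where "p = 4 ^ i" and "q = 4 ^ n"
    have p: "p \<ge> 1" and q: "q > 0" by (auto simp: p_def q_def)
    have "c n = \<bar>q * (2 - 16 * p)\<bar> / (q * (2 + 16 * p))"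
      unfolding c_def j i p_def q_def by (simp add: power_add algebra_simps)
    also have "\<dots> = (16 * p - 2) / (2 + 16 * p)" using p q by (simp add: abs_mult)
    finally have c: "c n = (16 * p - 2) / (2 + 16 * p)" .
    have un: "u n = 1 / (4 * p)" using False j i by (simp add: u_def p_def power_one_over)
    show ?thesis using p unfolding c un by (simp add: field_simps)
  qed
  have u01: "u n \<in> {0..1}" for n by (auto simp: u_def power_le_one)
  have "(1 / 3) * (1 / 9) \<le> (\<Prod>n\<in>{..<m} - S. c n) * (\<Prod>n\<in>{..<m} \<inter> S. c n)"
  proof (rule mult_mono)
    have "sum u ({..<m} - S) \<le> sum u ({Suc N..N + m} \<union> {..<N - 1})"
      using u01 by (intro sum_mono2) (auto simp: S_def)
    also have "\<dots> = sum u {Suc N..N + m} + sum u {..<N - 1}"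
      by (intro sum.union_disjoint) auto
    also have "sum u {Suc N..N + m} = (\<Sum>j\<in>{1..m}. (1 / 4) ^ j)"
      by (rule sum.reindex_bij_witness[of _ "\<lambda>j. j + N" "\<lambda>n. n - N"]) (auto simp: u_def)
    also have "sum u {..<N - 1} = (\<Sum>j\<in>{1..N - 1}. (1 / 4) ^ j)"
      by (rule sum.reindex_bij_witness[of _ "\<lambda>j. N - 1 - j" "\<lambda>n. N - 1 - n"]) (auto simp: u_def)
    also have "(\<Sum>j\<in>{1..m}. (1 / 4) ^ j) + (\<Sum>j\<in>{1..N - 1}. (1 / 4) ^ j) \<le> 1 / 3 + (1 / 3 :: real)"
      by (intro add_mono sum_geometric_quarter_le)
    finally have "1 / 3 \<le> 1 - sum u ({..<m} - S)" by simp
    also have "\<dots> \<le> (\<Prod>n\<in>{..<m} - S. 1 - u n)" by (rule Weierstrass_prod_ineq) (rule u01)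
    also have "\<dots> \<le> (\<Prod>n\<in>{..<m} - S. c n)" using u01 cu by (intro prod_mono) auto
    finally show "1 / 3 \<le> (\<Prod>n\<in>{..<m} - S. c n)" .
    have "card ({..<m} \<inter> S) \<le> card S" by (intro card_mono) (auto simp: S_def)
    also have "\<dots> \<le> 2" by (auto simp: S_def card_insert_if)
    finally have "(1 / 3 :: real) ^ 2 \<le> (1 / 3) ^ card ({..<m} \<inter> S)" by (intro power_decreasing) auto
    also have "\<dots> = (\<Prod>n\<in>{..<m} \<inter> S. 1 / 3)" by simp
    also have "\<dots> \<le> (\<Prod>n\<in>{..<m} \<inter> S. c n)" using cS by (intro prod_mono) auto
    finally show "1 / 9 \<le> (\<Prod>n\<in>{..<m} \<inter> S. c n)" by (simp add: power2_eq_square)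
  qed (auto intro: prod_nonneg c0)
  also have "\<dots> = (\<Prod>n<m. c n)"
    by (subst prod.union_disjoint[symmetric]) (auto intro!: prod.cong)
  also have "\<dots> \<le> (\<Prod>n<m. norm (blaschke_factor n (of_real (test_point N))))"
    using norm_blaschke_factor_test_point c0 unfolding c_def by (intro prod_mono) auto
  finally show ?thesis by (simp add: prod_norm)
qed

lemma norm_ex_B_test_point: "norm (ex_B (of_real (test_point N))) \<ge> 1 / 27"
proof (rule LIMSEQ_le_const)
  have "of_real (test_point N) \<in> slit_plane"
    using test_point_bounds[of N] ex_w_bounds[of "Suc N"] ball_subset_slit_plane by auto
  then show "(\<lambda>m. norm (\<Prod>n<m. blaschke_factor n (of_real (test_point N)))) \<longlonglongrightarrow> norm (ex_B (of_real (test_point N)))"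
    by (intro tendsto_norm ex_B_LIMSEQ)
qed (use norm_blaschke_partial_product_test_point in auto)

subsection \<open>Taylor coefficients and Abel sums\<close>

text \<open>Summation by parts writes each partial sum of the power series as an average of partial
  sums of \<open>c\<close>: the weights (1 - r) r^j for j < n together with r^n are nonnegative and
  add up to 1.\<close>

lemma power_series_abs_bounded:
  fixes c :: "nat \<Rightarrow> complex"
  assumes "summable c"
  obtains C where "\<And>r. 0 \<le> r \<Longrightarrow> r < 1 \<Longrightarrow> norm (\<Sum>j. c j * of_real r ^ j) \<le> C"
proof -
  define s where "s n = (\<Sum>j<n. c j)" for n
  have "convergent s" using assms unfolding s_def by (simp add: summable_iff_convergent)
  then have "Bseq s" by (rule convergent_imp_Bseq)
  then obtain C where C: "C > 0" "\<And>n. norm (s n) \<le> C" by (auto simp: Bseq_def)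
  have "norm (\<Sum>j. c j * of_real r ^ j) \<le> C" if r: "0 \<le> r" "r < 1" for r
  proof -
    let ?r = "complex_of_real r"
    have nr: "norm ?r < 1" using r by simp
    have part: "(\<Sum>j<n. c j * ?r ^ j) = (1 - ?r) * (\<Sum>j<n. s (Suc j) * ?r ^ j) + s n * ?r ^ n" for n
      by (induction n) (simp_all add: s_def algebra_simps)
    have "norm (\<Sum>j<n. c j * ?r ^ j) \<le> C * 1" for n
    proof -
      have "norm (\<Sum>j<n. c j * ?r ^ j) \<le> (1 - r) * (\<Sum>j<n. C * r ^ j) + C * r ^ n"
        unfolding part
      proof (intro norm_triangle_le add_mono)
        have "norm (\<Sum>j<n. s (Suc j) * ?r ^ j) \<le> (\<Sum>j<n. C * r ^ j)"
          using C r by (intro sum_norm_le) (auto simp: norm_mult norm_power intro!: mult_right_mono)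
        moreover have "norm (1 - ?r) = 1 - r"
          using r by (metis abs_of_pos diff_gt_0_iff_gt norm_of_real of_real_1 of_real_diff)
        ultimately show "norm ((1 - ?r) * (\<Sum>j<n. s (Suc j) * ?r ^ j)) \<le> (1 - r) * (\<Sum>j<n. C * r ^ j)"
          using r by (simp add: norm_mult mult_left_mono)
        show "norm (s n * ?r ^ n) \<le> C * r ^ n"
          using C r by (auto simp: norm_mult norm_power intro!: mult_right_mono)
      qed
      also have "\<dots> = C * ((1 - r) * (\<Sum>j<n. r ^ j) + r ^ n)"
        by (simp add: sum_distrib_left algebra_simps)
      also have "(1 - r) * (\<Sum>j<n. r ^ j) = 1 - r ^ n"
        by (simp add: one_diff_power_eq)
      finally show ?thesis by simp
    qed
    moreover have "(\<lambda>n. norm (\<Sum>j<n. c j * ?r ^ j)) \<longlonglongrightarrow> norm (\<Sum>j. c j * ?r ^ j)"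
    proof (intro tendsto_norm summable_LIMSEQ)
      \<comment> \<open>Terms of a convergent series are bounded, which gives absolute convergence
        for r < 1.\<close>
      obtain K where "\<And>j. norm (c j) \<le> K"
        using summable_LIMSEQ_zero[OF assms] convergent_imp_Bseq[of c] unfolding Bseq_def convergent_def by blast
      then show "summable (\<lambda>j. c j * ?r ^ j)"
        using Abel_lemma[of r 1 c K] r
        by (intro summable_norm_cancel[of "\<lambda>j. c j * ?r ^ j"]) (simp add: norm_mult norm_power)
    qed
    ultimately show ?thesis by (intro LIMSEQ_le_const2) auto
  qed
  then show ?thesis by (rule that)
qed

text \<open>The coefficients obtained by expanding every summand of \<open>ex_f\<close> as a
  geometric series; \<open>taylor_coeff_ex_f\<close> confirms that they are the Taylor
  coefficients.\<close>

definition test_coeff :: "nat \<Rightarrow> complex" where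
  "test_coeff j = (\<Sum>n. of_real ((1 / 2 ^ Suc n) * ex_w (Suc n) ^ j))"

text \<open>The double array is dominated by 2^-n |g j| |z|^j, because 0 \<le> w_n \<le> 1, so its
  sum may be taken in either order. Taking \<open>g\<close> constantly 1 gives the expansion of
  \<open>ex_f\<close>; taking the conjugated coefficients of phi turns the Abel sums into sums of
  values of phi.\<close>

lemma sum_swap_test_coeff:
  fixes g :: "nat \<Rightarrow> complex"
  assumes sm: "summable (\<lambda>j. norm (g j) * norm z ^ j)"
  shows "(\<lambda>j. test_coeff j * g j * z ^ j) sums
      (\<Sum>n. (1 / 2 ^ Suc n) * (\<Sum>j. g j * (of_real (ex_w (Suc n)) * z) ^ j))"
    "summable (\<lambda>n. (1 / 2 ^ Suc n) * (\<Sum>j. g j * (of_real (ex_w (Suc n)) * z) ^ j))"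
proof -
  have w: "0 \<le> ex_w (Suc n)" "ex_w (Suc n) \<le> 1" for n using ex_w_bounds(1,2)[of "Suc n"] by (auto intro: less_imp_le)
  define F where "F n j = of_real (1 / 2 ^ Suc n) * (g j * (of_real (ex_w (Suc n)) * z) ^ j)" for n j
  have nF: "norm (F n j) \<le> (1 / 2) ^ n * (norm (g j) * norm z ^ j)" for n j
  proof -
    have "norm (F n j) = (1 / 2) ^ Suc n * (ex_w (Suc n) ^ j * (norm (g j) * norm z ^ j))"
      using w[of n] by (simp add: F_def norm_mult norm_power norm_divide power_mult_distrib power_one_over mult_ac del: of_real_divide)
    also have "\<dots> \<le> (1 / 2) ^ n * (1 * (norm (g j) * norm z ^ j))"
    proof (rule mult_mono)
      show "(1 / 2 :: real) ^ Suc n \<le> (1 / 2) ^ n" by simp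
      show "ex_w (Suc n) ^ j * (norm (g j) * norm z ^ j) \<le> 1 * (norm (g j) * norm z ^ j)"
        using w[of n] by (intro mult_right_mono power_le_one) auto
    qed (use w[of n] in auto)
    finally show ?thesis by simp
  qed
  define G where "G = (\<Sum>j. norm (g j) * norm z ^ j)"
  have half: "summable (\<lambda>n. (1 / 2 :: real) ^ n)" by (intro summable_geometric) auto
  have hG: "((\<lambda>j. norm (g j) * norm z ^ j) has_sum G) UNIV"
    unfolding G_def using sm by (intro norm_summable_imp_has_sum summable_sums) auto
  have "(\<lambda>p. (1 / 2) ^ fst p * (norm (g (snd p)) * norm z ^ snd p)) summable_on UNIV \<times> UNIV"
  proof (rule summable_on_SigmaI)
    show "((\<lambda>j. (1 / 2) ^ fst (n, j) * (norm (g (snd (n, j))) * norm z ^ snd (n, j))) has_sum (1 / 2) ^ n * G) UNIV" for n :: nat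
      using has_sum_cmult_right[OF hG, of "(1 / 2) ^ n"] by simp
    show "(\<lambda>n. (1 / 2) ^ n * G) summable_on (UNIV :: nat set)"
      using half by (intro summable_on_cmult_left) (simp add: summable_on_UNIV_nonneg_real_iff)
  qed auto
  then have "(\<lambda>p. norm (F (fst p) (snd p))) summable_on UNIV \<times> UNIV"
    by (rule Infinite_Sum.abs_summable_on_comparison_test') (use nF in auto)
  then have "(\<lambda>p. F (fst p) (snd p)) summable_on UNIV \<times> UNIV"
    by (rule abs_summable_summable)
  then obtain T where T: "((\<lambda>p. F (fst p) (snd p)) has_sum T) (UNIV \<times> UNIV)"
    by (auto simp: summable_on_def)
  then have T': "((\<lambda>p. F (snd p) (fst p)) has_sum T) (UNIV \<times> UNIV)"
    by (subst has_sum_reindex_bij_witness[of _ prod.swap prod.swap]) auto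
  have row: "(F n has_sum (1 / 2 ^ Suc n) * (\<Sum>j. g j * (of_real (ex_w (Suc n)) * z) ^ j)) UNIV" for n
  proof -
    have "summable (\<lambda>j. norm (g j * (of_real (ex_w (Suc n)) * z) ^ j))"
    proof (rule summable_comparison_test'[OF sm, of 0])
      show "norm (norm (g j * (of_real (ex_w (Suc n)) * z) ^ j)) \<le> norm (g j) * norm z ^ j" for j
      proof -
        have "norm (of_real (ex_w (Suc n)) * z) \<le> 1 * norm z"
          using w[of n] unfolding norm_mult by (intro mult_right_mono) auto
        then have "norm (of_real (ex_w (Suc n)) * z) ^ j \<le> norm z ^ j"
          by (intro power_mono) auto
        then show ?thesis
          by (simp add: norm_mult[of "g j"] norm_power mult_left_mono del: norm_mult)
      qed
    qed
    from norm_summable_imp_has_sum[OF this summable_sums[OF summable_norm_cancel[OF this]]]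
    have "((\<lambda>j. g j * (of_real (ex_w (Suc n)) * z) ^ j) has_sum (\<Sum>j. g j * (of_real (ex_w (Suc n)) * z) ^ j)) UNIV" .
    from has_sum_cmult_right[OF this, of "of_real (1 / 2 ^ Suc n)"] show ?thesis
      unfolding F_def by simp
  qed
  have col: "((\<lambda>n. F n j) has_sum test_coeff j * g j * z ^ j) UNIV" for j
  proof -
    have "summable (\<lambda>n. norm (complex_of_real ((1 / 2 ^ Suc n) * ex_w (Suc n) ^ j)))"
    proof (rule summable_comparison_test'[OF half, of 0])
      show "norm (norm (complex_of_real ((1 / 2 ^ Suc n) * ex_w (Suc n) ^ j))) \<le> (1 / 2) ^ n" for n
      proof -
        have "(1 / 2 ^ Suc n) * ex_w (Suc n) ^ j \<le> (1 / 2 ^ n) * 1"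
          using w[of n] by (intro mult_mono power_le_one) (auto simp: field_simps)
        moreover have "0 \<le> (1 / 2 ^ Suc n) * ex_w (Suc n) ^ j" using w[of n] by simp
        ultimately show ?thesis
          by (simp only: norm_of_real real_norm_def abs_idempotent abs_of_nonneg power_one_over mult_1_right)
      qed
    qed
    from norm_summable_imp_has_sum[OF this summable_sums[OF summable_norm_cancel[OF this]]]
    have "((\<lambda>n. complex_of_real ((1 / 2 ^ Suc n) * ex_w (Suc n) ^ j)) has_sum test_coeff j) UNIV"
      unfolding test_coeff_def .
    from has_sum_cmult_left[OF this, of "g j * z ^ j"] show ?thesis
      by (simp add: F_def power_mult_distrib mult_ac)
  qed
  show "(\<lambda>j. test_coeff j * g j * z ^ j) sums (\<Sum>n. (1 / 2 ^ Suc n) * (\<Sum>j. g j * (of_real (ex_w (Suc n)) * z) ^ j))"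
    "summable (\<lambda>n. (1 / 2 ^ Suc n) * (\<Sum>j. g j * (of_real (ex_w (Suc n)) * z) ^ j))"
    using has_sum_imp_sums[OF has_sum_SigmaD[OF T]] has_sum_imp_sums[OF has_sum_SigmaD[OF T']] row col
    by (auto simp: sums_iff)
qed

lemma taylor_coeff_sums:
  assumes "f holomorphic_on ball 0 1" "norm z < 1"
  shows "(\<lambda>j. taylor_coeff f j * z ^ j) sums f z"
  unfolding taylor_coeff_def
  by (rule has_fps_expansion_imp_sums_complex[where r = 1])
    (use assms in \<open>auto intro!: has_fps_expansion_fps_expansion[of "ball 0 1"] simp: one_ereal_def\<close>)

lemma summable_norm_taylor_coeff:
  assumes "f holomorphic_on ball 0 1" "0 \<le> r" "r < 1"
  shows "summable (\<lambda>j. norm (taylor_coeff f j) * r ^ j)"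
proof -
  obtain s where s: "r < s" "s < 1" using dense assms(3) by blast
  have "summable (\<lambda>j. taylor_coeff f j * of_real s ^ j)"
    using taylor_coeff_sums[OF assms(1), of "of_real s"] s assms by (auto simp: sums_iff)
  from powser_insidea[OF this, of "of_real r"] show ?thesis
    using s assms by (simp add: norm_mult norm_power)
qed

lemma taylor_coeff_eqI:
  assumes "\<And>z. norm z < 1 \<Longrightarrow> (\<lambda>j. c j * z ^ j) sums f z"
  shows "taylor_coeff f j = c j"
proof -
  have "f has_fps_expansion Abs_fps c"
    unfolding has_fps_expansion_def
  proof
    have "summable (\<lambda>j. c j * (of_real (1/2)) ^ j)"
      using assms[of "of_real (1/2)"] by (simp add: sums_iff)
    then show "0 < fps_conv_radius (Abs_fps c)"
      using conv_radius_geI[of c "of_real (1/2)"] by (auto simp: fps_conv_radius_def zero_ereal_def intro: less_le_trans[of _ "ereal (1/2)"])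
    have "eventually (\<lambda>z::complex. z \<in> ball 0 1) (nhds 0)" by (intro eventually_nhds_in_open) auto
    then show "eventually (\<lambda>z. eval_fps (Abs_fps c) z = f z) (nhds 0)"
      by eventually_elim (use assms in \<open>auto simp: eval_fps_def sums_iff\<close>)
  qed
  then show ?thesis unfolding taylor_coeff_def by (simp add: fps_expansion_eqI)
qed

lemma taylor_coeff_ex_f: "taylor_coeff ex_f j = test_coeff j"
proof (rule taylor_coeff_eqI)
  fix z :: complex assume z: "norm z < 1"
  have "(\<lambda>j. test_coeff j * 1 * z ^ j) sums (\<Sum>n. (1 / 2 ^ Suc n) * (\<Sum>j. 1 * (of_real (ex_w (Suc n)) * z) ^ j))"
    by (rule sum_swap_test_coeff) (use z in \<open>auto intro: summable_geometric\<close>)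
  moreover have "(\<Sum>j. (of_real (ex_w (Suc n)) * z) ^ j) = 1 / (1 - of_real (ex_w (Suc n)) * z)" for n
  proof (rule suminf_geometric)
    have "norm (of_real (ex_w (Suc n)) * z) \<le> 1 * norm z"
      unfolding norm_mult by (intro mult_right_mono) (use ex_w_bounds[of "Suc n"] in auto)
    then show "norm (of_real (ex_w (Suc n)) * z) < 1" using z by simp
  qed
  ultimately show "(\<lambda>j. test_coeff j * z ^ j) sums ex_f z"
    by (simp add: ex_f_def)
qed

subsection \<open>The outer function of the pair\<close>

lemma tau_bounds: "0 < tau" "tau < 1" "tau\<^sup>2 = 1 - tau"
proof -
  have "sqrt 5 > 1" by simp
  moreover have "sqrt 5 < 3" by (rule real_less_lsqrt) auto
  ultimately show "0 < tau" "tau < 1" by (simp_all add: tau_def)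
  show "tau\<^sup>2 = 1 - tau" by (simp add: tau_def power2_eq_square field_simps)
qed

definition ex_a :: "complex \<Rightarrow> complex" where
  "ex_a z = of_real tau * (1 - z) / (1 - (of_real tau)\<^sup>2 * z)"

text \<open>A holomorphic logarithm of \<open>ex_a\<close> on the disk: 1 - z and 1 - tau^2 z have
  positive real part there, so principal branches can be taken separately. Its value at 0 is real.
  At z = 1 the convention for \<open>Ln 0\<close> intervenes, hence the hypotheses z \<noteq> 1
  below.\<close>

definition log_ex_a :: "complex \<Rightarrow> complex" where
  "log_ex_a z = of_real (ln tau) + Ln (1 - z) - Ln (1 - (of_real tau)\<^sup>2 * z)"

lemma norm_tau_sq_mult_le:
  fixes z :: complex
  shows "norm z \<le> 1 \<Longrightarrow> norm ((of_real tau)\<^sup>2 * z) \<le> 1 - tau"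
  using tau_bounds mult_left_le[of "norm z" "1 - tau"]
  by (simp add: norm_mult norm_power del: of_real_power)

lemma ex_a_denom_bounds:
  assumes "norm z \<le> 1"
  shows "tau \<le> norm (1 - (of_real tau)\<^sup>2 * z)" "norm (1 - (of_real tau)\<^sup>2 * z) \<le> 2"
    "0 < Re (1 - (of_real tau)\<^sup>2 * z)"
proof -
  let ?w = "(of_real tau)\<^sup>2 * z"
  have w: "norm ?w \<le> 1 - tau" using norm_tau_sq_mult_le[OF assms] .
  show "tau \<le> norm (1 - ?w)" using norm_triangle_ineq2[of 1 ?w] w by simp
  show "norm (1 - ?w) \<le> 2" using norm_triangle_ineq4[of 1 ?w] w tau_bounds by simp
  show "0 < Re (1 - ?w)" using complex_Re_le_cmod[of ?w] w tau_bounds by simp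
qed

lemma exp_log_ex_a:
  assumes "norm z \<le> 1" "z \<noteq> 1"
  shows "exp (log_ex_a z) = ex_a z"
proof -
  have "1 - (of_real tau)\<^sup>2 * z \<noteq> 0" using ex_a_denom_bounds(1)[OF assms(1)] tau_bounds by auto
  moreover have "1 - z \<noteq> 0" using assms by auto
  ultimately show ?thesis using tau_bounds
    by (simp add: log_ex_a_def ex_a_def exp_add exp_diff exp_of_real)
qed

lemma Re_log_ex_a:
  assumes "norm z \<le> 1" "z \<noteq> 1"
  shows "Re (log_ex_a z) = ln tau + ln (norm (1 - z)) - ln (norm (1 - (of_real tau)\<^sup>2 * z))"
proof -
  have "1 - (of_real tau)\<^sup>2 * z \<noteq> 0" using ex_a_denom_bounds(1)[OF assms(1)] tau_bounds by auto
  moreover have "1 - z \<noteq> 0" using assms by auto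
  ultimately show ?thesis by (simp add: log_ex_a_def)
qed

lemma ln_norm_ex_a:
  assumes "norm z \<le> 1" "z \<noteq> 1"
  shows "ln (norm (ex_a z)) = Re (log_ex_a z)"
  using exp_log_ex_a[OF assms] by (metis ln_exp norm_exp_eq_Re)

text \<open>The dilation moves the singularity at 1 out of the closed disk, so that
  \<open>Schwarz_formula\<close> becomes applicable.\<close>

lemma log_ex_a_holomorphic:
  assumes "0 \<le> r" "r < 1"
  shows "(\<lambda>z. log_ex_a (of_real r * z)) holomorphic_on ball 0 1"
    "continuous_on (cball 0 1) (\<lambda>z. log_ex_a (of_real r * z))"
proof -
  have "(\<lambda>z. log_ex_a (of_real r * z)) holomorphic_on cball 0 1"
  proof -
    have 1: "1 - of_real r * z \<notin> \<real>\<^sub>\<le>\<^sub>0" "1 - (of_real tau)\<^sup>2 * (of_real r * z) \<notin> \<real>\<^sub>\<le>\<^sub>0" if "z \<in> cball 0 1" for z :: complex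
    proof -
      have n: "norm (of_real r * z) \<le> r" using that assms by (simp add: norm_mult mult_left_le)
      have "Re (of_real r * z) < 1" using complex_Re_le_cmod[of "of_real r * z"] n assms by linarith
      then show "1 - of_real r * z \<notin> \<real>\<^sub>\<le>\<^sub>0" by (auto simp: complex_nonpos_Reals_iff)
      show "1 - (of_real tau)\<^sup>2 * (of_real r * z) \<notin> \<real>\<^sub>\<le>\<^sub>0"
        using ex_a_denom_bounds(3)[of "of_real r * z"] n assms by (auto simp: complex_nonpos_Reals_iff)
    qed
    show ?thesis unfolding log_ex_a_def by (intro holomorphic_intros) (use 1 in auto)
  qed
  then show "(\<lambda>z. log_ex_a (of_real r * z)) holomorphic_on ball 0 1"
    "continuous_on (cball 0 1) (\<lambda>z. log_ex_a (of_real r * z))"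
    using holomorphic_on_subset ball_subset_cball holomorphic_on_imp_continuous_on by blast+
qed

lemma isCont_log_ex_a:
  assumes "norm z \<le> 1" "z \<noteq> 1"
  shows "isCont log_ex_a z"
proof -
  have "Re z < 1"
  proof (rule ccontr)
    assume "\<not> Re z < 1"
    then have re: "Re z = 1" using complex_Re_le_cmod[of z] assms by linarith
    then have "Im z = 0" using assms(1) cmod_power2[of z] power_mono[of "norm z" 1 2] by auto
    with re assms(2) show False by (simp add: complex_eq_iff)
  qed
  then have "1 - z \<notin> \<real>\<^sub>\<le>\<^sub>0" by (auto simp: complex_nonpos_Reals_iff)
  moreover have "1 - (of_real tau)\<^sup>2 * z \<notin> \<real>\<^sub>\<le>\<^sub>0"
    using ex_a_denom_bounds(3)[OF assms(1)] by (auto simp: complex_nonpos_Reals_iff)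
  ultimately show ?thesis unfolding log_ex_a_def by (intro continuous_intros) auto
qed

text \<open>Both |1 - z| \<le> |1 - r z| + (1 - r) and 1 - r \<le> |1 - r z| hold: shrinking the
  radius at most halves the distance to 1. So the logarithm of that distance falls by at most ln
  2.\<close>

lemma norm_one_minus_scaled:
  fixes z :: complex
  assumes "0 \<le> r" "r \<le> 1" "norm z = 1"
  shows "norm (1 - z) \<le> 2 * norm (1 - of_real r * z)"
proof -
  have "norm (1 - z) \<le> norm (1 - of_real r * z) + norm (of_real r * z - z)"
    using norm_triangle_ineq[of "1 - of_real r * z" "of_real r * z - z"] by simp
  also have "of_real r * z - z = - (of_real (1 - r) * z)" by (simp add: algebra_simps)
  also have "norm (- (of_real (1 - r) * z)) = 1 - r"
    using assms by (simp add: norm_mult del: of_real_diff)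
  also have "1 - r \<le> norm (1 - of_real r * z)"
    using norm_triangle_ineq2[of 1 "of_real r * z"] assms by (simp add: norm_mult)
  finally show ?thesis by simp
qed

text \<open>A majorant independent of \<open>r\<close>, for dominated convergence as r tends to 1.
  At r z and at z alike, |ln tau| enters once through the numerator and once through the
  denominator. The denominators give ln 2 twice, and \<open>norm_one_minus_scaled\<close> gives the
  third.\<close>

lemma Re_log_ex_a_bound:
  assumes "0 \<le> r" "r < 1" "norm z = 1" "z \<noteq> 1"
  shows "\<bar>Re (log_ex_a (of_real r * z))\<bar> \<le> \<bar>Re (log_ex_a z)\<bar> + (4 * \<bar>ln tau\<bar> + 3 * ln 2)"
proof -
  have nr: "norm (of_real r * z) \<le> 1" using assms by (simp add: norm_mult)
  have r1: "of_real r * z \<noteq> 1"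
  proof
    assume "of_real r * z = 1"
    then have "norm (of_real r * z) = 1" by simp
    then show False using assms by (simp add: norm_mult)
  qed
  have D: "\<bar>ln (norm (1 - (of_real tau)\<^sup>2 * w))\<bar> \<le> \<bar>ln tau\<bar> + ln 2" if "norm w \<le> 1" for w :: complex
  proof -
    have "ln tau \<le> ln (norm (1 - (of_real tau)\<^sup>2 * w))" "ln (norm (1 - (of_real tau)\<^sup>2 * w)) \<le> ln 2"
      using ex_a_denom_bounds(1,2)[OF that] tau_bounds
      by (subst ln_le_cancel_iff; linarith)+
    moreover have "0 < ln (2::real)" by simp
    ultimately show ?thesis by linarith
  qed
  have N: "\<bar>ln (norm (1 - of_real r * z))\<bar> \<le> \<bar>ln (norm (1 - z))\<bar> + ln 2"
  proof -
    have p: "0 < norm (1 - z)" "0 < norm (1 - of_real r * z)" using r1 assms by auto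
    have "norm (1 - of_real r * z) \<le> 2"
      using norm_triangle_ineq4[of 1 "of_real r * z"] nr by simp
    then have "ln (norm (1 - of_real r * z)) \<le> ln 2" using p by (subst ln_le_cancel_iff) auto
    moreover have "ln (norm (1 - z)) \<le> ln (2 * norm (1 - of_real r * z))"
      using p norm_one_minus_scaled[of r z] assms by (subst ln_le_cancel_iff) auto
    then have "ln (norm (1 - z)) \<le> ln 2 + ln (norm (1 - of_real r * z))"
      using p by (simp add: ln_mult)
    ultimately show ?thesis by linarith
  qed
  show ?thesis
    using D[OF nr] D[of z] N assms(3)
    unfolding Re_log_ex_a[OF nr r1] Re_log_ex_a[OF eq_refl[OF assms(3)] assms(4)] by linarith
qed

lemma cis_ne_1: "t \<in> {0<..<2*pi} \<Longrightarrow> cis t \<noteq> 1"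
  using cis_in_slit_plane[of t] by (metis (mono_tags, lifting) ComplD Reals_1 mem_Collect_eq one_complex.sel(1) order_refl slit_plane_def)

text \<open>By the golden ratio relation tau^4 = 3 tau^2 - 1, hence |1 - tau^2 u|^2 = tau^2 (3 - 2
  cos t) = tau^2 |1 - u|^2 + tau^2 for u = \<open>cis t\<close>, the sum of the two squared
  numerators.\<close>

lemma norm_ex_a_cis: "(norm (ex_a (cis t)))\<^sup>2 + (norm (ex_b0 (cis t)))\<^sup>2 = 1"
proof -
  have d: "norm (1 - (of_real tau)\<^sup>2 * cis t) > 0"
    by (rule less_le_trans[OF tau_bounds(1) ex_a_denom_bounds(1)]) simp
  have sc: "(sin t)\<^sup>2 = 1 - (cos t)\<^sup>2" by (simp add: sin_squared_eq)
  have 1: "(norm (1 - cis t))\<^sup>2 = 2 - 2 * cos t"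
    by (simp add: cmod_power2 power2_diff sc)
  have "(norm (1 - (of_real tau)\<^sup>2 * cis t))\<^sup>2 = (1 - tau\<^sup>2 * cos t)\<^sup>2 + (tau\<^sup>2 * sin t)\<^sup>2"
    unfolding cmod_power2 by (simp flip: of_real_power)
  also have "\<dots> = 1 + (tau\<^sup>2)\<^sup>2 - 2 * tau\<^sup>2 * cos t"
    by (simp add: power2_diff power_mult_distrib sc algebra_simps)
  also have "(tau\<^sup>2)\<^sup>2 = 3 * tau\<^sup>2 - 1"
    using tau_bounds(3) by (simp add: power2_diff)
  finally have 2: "(norm (1 - (of_real tau)\<^sup>2 * cis t))\<^sup>2 = tau\<^sup>2 * (3 - 2 * cos t)"
    by (simp add: algebra_simps)
  have "(norm (ex_a (cis t)))\<^sup>2 + (norm (ex_b0 (cis t)))\<^sup>2 =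
      (tau\<^sup>2 * (norm (1 - cis t))\<^sup>2 + tau\<^sup>2) / (norm (1 - (of_real tau)\<^sup>2 * cis t))\<^sup>2"
    by (simp add: ex_a_def ex_b0_def norm_divide norm_mult power_divide power_mult_distrib add_divide_distrib)
  also have "tau\<^sup>2 * (norm (1 - cis t))\<^sup>2 + tau\<^sup>2 = (norm (1 - (of_real tau)\<^sup>2 * cis t))\<^sup>2"
    unfolding 1 2 by (simp add: algebra_simps)
  also have "\<dots> / (norm (1 - (of_real tau)\<^sup>2 * cis t))\<^sup>2 = 1" using d by simp
  finally show ?thesis .
qed

section \<open>Schwarz integrals of integrable exponents\<close>

definition schwarz_kernel :: "complex \<Rightarrow> real \<Rightarrow> complex" where
  "schwarz_kernel z t = (cis t + z) / (cis t - z)"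

lemma norm_schwarz_kernel_le:
  assumes "z \<in> ball 0 1"
  shows "norm (schwarz_kernel z t) \<le> 2 / (1 - norm z)"
proof -
  have "norm (cis t + z) \<le> 2" using norm_triangle_ineq[of "cis t" z] assms by simp
  moreover have "1 - norm z \<le> norm (cis t - z)" using norm_triangle_ineq2[of "cis t" z] by simp
  ultimately show ?thesis using assms unfolding schwarz_kernel_def norm_divide
    by (intro frac_le) auto
qed

lemma measurable_schwarz_kernel [measurable]: "schwarz_kernel z \<in> borel_measurable borel"
  unfolding schwarz_kernel_def by measurable

lemma integrable_schwarz_kernel_mult:
  assumes "integrable circle_measure k" "z \<in> ball 0 1"
  shows "integrable circle_measure (\<lambda>t. schwarz_kernel z t * of_real (k t))"
proof (rule Bochner_Integration.integrable_bound)
  show "integrable circle_measure (\<lambda>t. 2 / (1 - norm z) * \<bar>k t\<bar>)"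
    using assms(1) by (intro integrable_mult_right integrable_abs)
  have [measurable]: "k \<in> borel_measurable circle_measure" using assms by auto
  have [measurable]: "schwarz_kernel z \<in> borel_measurable circle_measure"
    by (intro measurable_restrict_space1) simp
  show "(\<lambda>t. schwarz_kernel z t * of_real (k t)) \<in> borel_measurable circle_measure"
    by measurable
  show "AE t in circle_measure. norm (schwarz_kernel z t * of_real (k t)) \<le> norm (2 / (1 - norm z) * \<bar>k t\<bar>)"
  proof (rule AE_I2)
    fix t
    have "norm (schwarz_kernel z t) * \<bar>k t\<bar> \<le> 2 / (1 - norm z) * \<bar>k t\<bar>"
      by (intro mult_right_mono norm_schwarz_kernel_le assms) auto
    then show "norm (schwarz_kernel z t * of_real (k t)) \<le> norm (2 / (1 - norm z) * \<bar>k t\<bar>)"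
      using assms(2) by (simp add: norm_mult abs_mult)
  qed
qed

lemma has_integral_circle_measure:
  fixes f :: "real \<Rightarrow> 'a :: euclidean_space"
  assumes "integrable circle_measure f"
  shows "(f has_integral (\<integral>t. f t \<partial>circle_measure)) {0..2*pi}"
proof -
  have i: "set_integrable lborel {0..2*pi} f"
    using assms by (simp add: set_integrable_def integrable_restrict_space)
  then show ?thesis
    using set_borel_integral_eq_integral[OF i]
    by (simp add: integral_restrict_space set_lebesgue_integral_def has_integral_integrable_integral)
qed

lemma Re_integral_schwarz_kernel:
  assumes "integrable circle_measure k" "z \<in> ball 0 1"
  shows "Re (\<integral>t. schwarz_kernel z t * of_real (k t) \<partial>circle_measure) = 2 * pi * poisson_integral k z"
proof -
  have "Re (schwarz_kernel z t * of_real (k t)) = poisson_kernel z t * k t" for t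
    by (simp add: poisson_kernel_def schwarz_kernel_def del: times_divide_eq_left)
  then have "((\<lambda>t. poisson_kernel z t * k t) has_integral Re (\<integral>t. schwarz_kernel z t * of_real (k t) \<partial>circle_measure)) {0..2*pi}"
    using has_integral_Re[OF has_integral_circle_measure[OF integrable_schwarz_kernel_mult[OF assms]]]
    by (simp only:)
  from has_integral_unique[OF this has_integral_circle_measure[OF integrable_poisson_kernel_mult[OF assms]]]
  show ?thesis by (simp add: poisson_integral_def)
qed

lemma AE_lebesgue_on_circle:
  assumes "AE t in lebesgue_on {0..2*pi}. P t"
  shows "AE t in circle_measure. P t"
proof -
  have "AE t in lebesgue. t \<in> {0..2*pi} \<longrightarrow> P t"
    using assms by (subst (asm) AE_restrict_space_iff) auto
  then have "AE t in lborel. t \<in> {0..2*pi} \<longrightarrow> P t" by (simp only: AE_completion_iff)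
  then show ?thesis by (subst AE_restrict_space_iff; (assumption | simp))
qed

text \<open>The exponent of an outer function is only Lebesgue measurable. Changing it on a null set
  yields a Borel function with the same Schwarz integrals, to which the results on Poisson integrals
  apply.\<close>

lemma outer_function_borel_exponent:
  assumes "k absolutely_integrable_on {0..2*pi}"
  obtains h where "h \<in> borel_measurable borel" "integrable circle_measure h"
    "\<And>z. z \<in> ball 0 1 \<Longrightarrow> integral {0..2*pi} (\<lambda>t. (cis t + z) / (cis t - z) * of_real (k t))
        = (\<integral>t. schwarz_kernel z t * of_real (h t) \<partial>circle_measure)"
proof -
  have ik: "integrable lebesgue (\<lambda>t. indicator {0..2*pi} t * k t)"
    using assms by (simp add: set_integrable_def)
  obtain h where h: "h \<in> borel_measurable lborel" "AE t in lborel. indicator {0..2*pi} t * k t = h t"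
    using completion_ex_borel_measurable_real[of "\<lambda>t. indicator {0..2*pi} t * k t" lborel] ik
    by blast
  have hb [measurable]: "h \<in> borel_measurable borel" using h(1) by simp
  have ael: "AE t in lebesgue. indicator {0..2*pi} t * k t = h t"
    using h(2) by (simp add: AE_completion)
  have "integrable lebesgue h"
    using ik ael by (subst (asm) integrable_cong_AE[of _ _ h]) (auto simp: measurable_completion borel_measurable_integrable[OF ik])
  then have "integrable lborel h" by (subst (asm) integrable_completion) auto
  then have ih: "integrable circle_measure h"
    using integrable_mult_indicator[OF _ \<open>integrable lborel h\<close>, of "{0..2*pi}"]
    by (simp add: integrable_restrict_space)
  obtain N where N: "N \<in> null_sets lebesgue" "\<And>t. t \<notin> N \<Longrightarrow> indicator {0..2*pi} t * k t = h t"
    using AE_E3[OF ael] by (metis DiffI UNIV_I space_completion space_lborel space_borel)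
  show ?thesis
  proof (rule that[OF hb ih])
    fix z :: complex assume z: "z \<in> ball 0 1"
    have "integral {0..2*pi} (\<lambda>t. (cis t + z) / (cis t - z) * of_real (k t))
       = integral {0..2*pi} (\<lambda>t. schwarz_kernel z t * of_real (h t))"
    proof (rule integral_spike[of N])
      show "negligible N" using N(1) by (simp add: negligible_iff_null_sets)
      fix t assume "t \<in> {0..2*pi} - N"
      then have "h t = k t" using N(2)[of t] by auto
      then show "schwarz_kernel z t * of_real (h t) = (cis t + z) / (cis t - z) * of_real (k t)"
        by (simp add: schwarz_kernel_def)
    qed
    also have "\<dots> = (\<integral>t. schwarz_kernel z t * of_real (h t) \<partial>circle_measure)"
      using has_integral_circle_measure[OF integrable_schwarz_kernel_mult[OF ih z]]
      by (rule integral_unique)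
    finally show "integral {0..2*pi} (\<lambda>t. (cis t + z) / (cis t - z) * of_real (k t))
       = (\<integral>t. schwarz_kernel z t * of_real (h t) \<partial>circle_measure)" .
  qed
qed

text \<open>
  The integrability of \<open>ln (norm (ex_a (cis t)))\<close> comes for free, since this function agrees with the
  integrable \<open>h\<close>.
\<close>
lemma integral_schwarz_kernel_log_ex_a:
  assumes ih: "integrable circle_measure h" and z: "z \<in> ball 0 1"
    and eq: "AE t in circle_measure. h t = ln (norm (ex_a (cis t)))"
  shows "(\<integral>t. schwarz_kernel z t * of_real (h t) \<partial>circle_measure) = 2 * of_real pi * log_ex_a z"
proof -
  define r :: "nat \<Rightarrow> real" where "r n = 1 - 1 / (real n + 1)" for n
  have r01: "0 \<le> r n" "r n < 1" for n by (auto simp: r_def)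
  have r1: "r \<longlonglongrightarrow> 1" unfolding r_def by real_asymp
  define G where "G n u = log_ex_a (of_real (r n) * u)" for n u
  have G: "continuous_on (cball 0 1) (G n)" "G n holomorphic_on ball 0 1" for n
    unfolding G_def using log_ex_a_holomorphic[OF r01] by auto
  define C where "C = 4 * \<bar>ln tau\<bar> + 3 * ln 2"
  have [measurable]: "h \<in> borel_measurable circle_measure" using ih by auto
  have iG: "integrable circle_measure (\<lambda>t. schwarz_kernel z t * of_real (Re (G n (cis t))))" for n
    by (rule integrable_schwarz_kernel_mult[OF poisson_integral_Re(1)[OF G z] z])
  have lim1: "(\<lambda>n. \<integral>t. schwarz_kernel z t * of_real (Re (G n (cis t))) \<partial>circle_measure)
      \<longlonglongrightarrow> (\<integral>t. schwarz_kernel z t * of_real (h t) \<partial>circle_measure)"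
  proof (rule integral_dominated_convergence[where w = "\<lambda>t. 2 / (1 - norm z) * (\<bar>h t\<bar> + C)"])
    show "(\<lambda>t. schwarz_kernel z t * of_real (h t)) \<in> borel_measurable circle_measure"
      using integrable_schwarz_kernel_mult[OF ih z] by auto
    show "(\<lambda>t. schwarz_kernel z t * of_real (Re (G n (cis t)))) \<in> borel_measurable circle_measure" for n
      using iG by auto
    show "integrable circle_measure (\<lambda>t. 2 / (1 - norm z) * (\<bar>h t\<bar> + C))"
      using ih by (intro integrable_mult_right Bochner_Integration.integrable_add integrable_abs) auto
    show "AE t in circle_measure. (\<lambda>n. schwarz_kernel z t * of_real (Re (G n (cis t)))) \<longlonglongrightarrow> schwarz_kernel z t * of_real (h t)"
      using eq AE_circle_interior
    proof eventually_elim
      case (elim t)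
      have "(\<lambda>n. of_real (r n) * cis t) \<longlonglongrightarrow> of_real 1 * cis t" by (intro tendsto_intros r1)
      then have "(\<lambda>n. G n (cis t)) \<longlonglongrightarrow> log_ex_a (cis t)"
        unfolding G_def using isCont_log_ex_a[of "cis t"] cis_ne_1[OF elim(2)]
        by (intro isCont_tendsto_compose[of _ log_ex_a]) auto
      moreover have "h t = Re (log_ex_a (cis t))"
        using elim ln_norm_ex_a[of "cis t"] cis_ne_1[OF elim(2)] by simp
      ultimately show ?case by (auto intro!: tendsto_intros)
    qed
    show "AE t in circle_measure. norm (schwarz_kernel z t * of_real (Re (G n (cis t)))) \<le> 2 / (1 - norm z) * (\<bar>h t\<bar> + C)" for n
      using eq AE_circle_interior
    proof eventually_elim
      case (elim t)
      have "h t = Re (log_ex_a (cis t))"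
        using elim ln_norm_ex_a[of "cis t"] cis_ne_1[OF elim(2)] by simp
      then have "\<bar>Re (G n (cis t))\<bar> \<le> \<bar>h t\<bar> + C"
        unfolding G_def C_def using Re_log_ex_a_bound[OF r01, of "cis t" n] cis_ne_1[OF elim(2)] by simp
      then have "norm (schwarz_kernel z t) * \<bar>Re (G n (cis t))\<bar> \<le> 2 / (1 - norm z) * (\<bar>h t\<bar> + C)"
        using z by (intro mult_mono norm_schwarz_kernel_le) auto
      then show ?case by (simp add: norm_mult)
    qed
  qed
  have "(\<integral>t. schwarz_kernel z t * of_real (Re (G n (cis t))) \<partial>circle_measure)
      = 2 * of_real pi * log_ex_a (of_real (r n) * z)" for n
  proof -
    have "((\<lambda>t. schwarz_kernel z t * of_real (Re (G n (cis t)))) has_integral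
        2 * of_real pi * (G n z - \<i> * of_real (Im (G n 0)))) {0..2*pi}"
      unfolding schwarz_kernel_def by (rule Schwarz_formula[OF G z])
    \<comment> \<open>The imaginary constant of the Schwarz formula vanishes because
      \<open>log_ex_a 0\<close> is the real number \<open>ln tau\<close>.\<close>
    from has_integral_unique[OF has_integral_circle_measure[OF iG] this] show ?thesis
      by (simp add: G_def log_ex_a_def)
  qed
  moreover have "(\<lambda>n. 2 * of_real pi * log_ex_a (of_real (r n) * z)) \<longlonglongrightarrow> 2 * of_real pi * log_ex_a z"
  proof -
    have z1: "z \<noteq> 1" using z by auto
    have "(\<lambda>n. of_real (r n) * z) \<longlonglongrightarrow> of_real 1 * z" by (intro tendsto_intros r1)
    then have "(\<lambda>n. log_ex_a (of_real (r n) * z)) \<longlonglongrightarrow> log_ex_a z"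
      using isCont_log_ex_a[of z] z z1 by (intro isCont_tendsto_compose[of _ log_ex_a]) auto
    then show ?thesis by (intro tendsto_intros)
  qed
  ultimately show ?thesis using LIMSEQ_unique[OF lim1] by simp
qed

text \<open>Away from the point 1 the function \<open>ex_b\<close> is continuous at the boundary, so
  its radial limit is its value, and \<open>ex_B\<close> contributes modulus 1.\<close>

lemma radial_limit_ex_b:
  assumes t: "t \<in> {0<..<2*pi}" and b: "radial_limit ex_b t \<beta>"
  shows "norm \<beta> = norm (ex_b0 (cis t))"
proof -
  have "isCont ex_B (cis t)"
    using holomorphic_on_imp_continuous_on[OF ex_B_holomorphic] cis_in_slit_plane[OF t] open_slit_plane
    by (simp add: continuous_on_eq_continuous_at)
  moreover have "1 - (of_real tau)\<^sup>2 * cis t \<noteq> 0"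
    using ex_a_denom_bounds(1)[of "cis t"] tau_bounds by auto
  ultimately have c: "isCont ex_b (cis t)"
    unfolding ex_b_def ex_b0_def by (intro continuous_intros) auto
  have "((\<lambda>r. of_real r * cis t) \<longlongrightarrow> of_real 1 * cis t) (at_left 1)"
    by (intro tendsto_intros)
  then have "((\<lambda>r. ex_b (of_real r * cis t)) \<longlongrightarrow> ex_b (cis t)) (at_left 1)"
    using c by (intro isCont_tendsto_compose[of _ ex_b]) auto
  with b have "\<beta> = ex_b (cis t)"
    unfolding radial_limit_def by (intro tendsto_unique[of "at_left (1::real)"]) auto
  then show ?thesis by (simp add: ex_b_def norm_mult norm_power norm_ex_B_cis[OF t])
qed

text \<open>On the disk ln |a| is the Poisson integral of the Borel exponent \<open>h\<close>, and
  its radial limits are forced by those of \<open>ex_b\<close>. This determines \<open>h\<close>,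
  hence the whole Schwarz integral and not only its real part. Only the unimodular constant
  \<open>c\<close> remains.\<close>

lemma is_pair_ex_b:
  assumes pair: "is_pair ex_b a" and z: "z \<in> ball 0 1"
  shows "a z = ex_a z"
proof -
  obtain c k where c: "norm c = 1" and k: "k absolutely_integrable_on {0..2*pi}"
    and a: "\<And>z. z \<in> ball 0 1 \<Longrightarrow> a z = c * exp (of_real (1 / (2*pi)) *
        integral {0..2*pi} (\<lambda>t. (cis t + z) / (cis t - z) * of_real (k t)))"
    using pair unfolding is_pair_def outer_function_def by blast
  obtain h where h: "h \<in> borel_measurable borel" "integrable circle_measure h"
    "\<And>z. z \<in> ball 0 1 \<Longrightarrow> integral {0..2*pi} (\<lambda>t. (cis t + z) / (cis t - z) * of_real (k t))
        = (\<integral>t. schwarz_kernel z t * of_real (h t) \<partial>circle_measure)"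
    using outer_function_borel_exponent[OF k] by blast
  have norm_a: "norm (a z) = exp (poisson_integral h z)" if z: "z \<in> ball 0 1" for z
  proof -
    have "Re (of_real (1 / (2*pi)) * (\<integral>t. schwarz_kernel z t * of_real (h t) \<partial>circle_measure))
        = 1 / (2*pi) * Re (\<integral>t. schwarz_kernel z t * of_real (h t) \<partial>circle_measure)"
      by (simp only: Re_complex_of_real Im_complex_of_real times_complex.sel mult_zero_left diff_zero)
    also have "\<dots> = poisson_integral h z"
      unfolding Re_integral_schwarz_kernel[OF h(2) z] by simp
    finally show ?thesis
      unfolding a[OF z] h(3)[OF z] norm_mult c norm_exp_eq_Re by simp
  qed
  have "AE t in circle_measure. \<exists>\<alpha> \<beta>. radial_limit a t \<alpha> \<and> radial_limit ex_b t \<beta> \<and> (norm \<alpha>)\<^sup>2 + (norm \<beta>)\<^sup>2 = 1"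
    using pair unfolding is_pair_def by (intro AE_lebesgue_on_circle) auto
  then have "AE t in circle_measure.
      ((\<lambda>r. poisson_integral h (of_real r * cis t)) \<longlongrightarrow> ln (norm (ex_a (cis t)))) (at_left 1)"
    using AE_circle_interior
  proof eventually_elim
    case (elim t)
    then obtain \<alpha> \<beta> where \<alpha>: "radial_limit a t \<alpha>" and \<beta>: "radial_limit ex_b t \<beta>"
      and 1: "(norm \<alpha>)\<^sup>2 + (norm \<beta>)\<^sup>2 = 1" by blast
    have "(norm \<alpha>)\<^sup>2 = (norm (ex_a (cis t)))\<^sup>2"
      using 1 norm_ex_a_cis[of t] unfolding radial_limit_ex_b[OF elim(2) \<beta>] by linarith
    then have n: "norm \<alpha> = norm (ex_a (cis t))" by (metis norm_ge_zero power2_eq_iff_nonneg)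
    have "ex_a (cis t) \<noteq> 0"
      using exp_log_ex_a[of "cis t"] cis_ne_1[OF elim(2)] by (metis exp_not_eq_zero norm_cis order_refl)
    then have "((\<lambda>r. ln (norm (a (of_real r * cis t)))) \<longlongrightarrow> ln (norm \<alpha>)) (at_left 1)"
      using \<alpha> n unfolding radial_limit_def by (intro tendsto_ln tendsto_norm) auto
    moreover have "eventually (\<lambda>r::real. r \<in> {0<..<1}) (at_left 1)"
      by (rule eventually_at_left_real) simp
    then have "eventually (\<lambda>r. ln (norm (a (of_real r * cis t))) = poisson_integral h (of_real r * cis t)) (at_left 1)"
      by eventually_elim (simp add: norm_a norm_mult)
    ultimately show ?case unfolding n by (rule Lim_transform_eventually)
  qed
  from poisson_integral_radial_limit_unique[OF h(1,2) this]
  have eq: "AE t in circle_measure. h t = ln (norm (ex_a (cis t)))" .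
  have az: "a z = c * ex_a z" if z: "z \<in> ball 0 1" for z
  proof -
    have "a z = c * exp (log_ex_a z)"
      unfolding a[OF z] h(3)[OF z] integral_schwarz_kernel_log_ex_a[OF h(2) z eq] by simp
    then show ?thesis using z exp_log_ex_a[of z] by force
  qed
  \<comment> \<open>Positivity of \<open>a 0\<close> and of \<open>tau\<close> makes
    \<open>c\<close> a positive number, and |c| = 1 leaves only 1.\<close>
  have "a 0 = c * of_real tau" using az[of 0] by (simp add: ex_a_def)
  then have c': "c = of_real (Re (a 0) / tau)"
    using pair tau_bounds(1) unfolding is_pair_def by (auto simp: complex_eq_iff complex_is_Real_iff)
  have "Re (a 0) / tau > 0" using pair tau_bounds(1) by (simp add: is_pair_def)
  with c have "Re (a 0) / tau = 1" unfolding c' norm_of_real by (simp only: abs_of_pos)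
  with c' have "c = 1" by simp
  then show ?thesis using az[OF z] by simp
qed

section \<open>The quotient phi and divergence of the pairing\<close>

lemma ex_b_div_ex_a:
  assumes "z \<in> ball 0 1"
  shows "ex_b z / ex_a z = z * (ex_B z)\<^sup>2 / (1 - z)"
proof -
  have "1 - (of_real tau)\<^sup>2 * z \<noteq> 0" using ex_a_denom_bounds(1)[of z] assms tau_bounds by auto
  then show ?thesis using tau_bounds(1) by (simp add: ex_b_def ex_b0_def ex_a_def)
qed

theorem corollary3p5:
  fixes a \<phi> :: "complex \<Rightarrow> complex"
  assumes "is_pair ex_b a"
    and "\<And>z. z \<in> ball 0 1 \<Longrightarrow> \<phi> z = ex_b z / a z"
  shows "\<not> summable (\<lambda>j. taylor_coeff ex_f j * cnj (taylor_coeff \<phi> j))"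
proof
  define g where "g j = cnj (taylor_coeff \<phi> j)" for j
  assume "summable (\<lambda>j. taylor_coeff ex_f j * cnj (taylor_coeff \<phi> j))"
  then have "summable (\<lambda>j. test_coeff j * g j)" by (simp add: taylor_coeff_ex_f g_def)
  then obtain C where C: "\<And>r. 0 \<le> r \<Longrightarrow> r < 1 \<Longrightarrow> norm (\<Sum>j. test_coeff j * g j * of_real r ^ j) \<le> C"
    using power_series_abs_bounded by blast
  have \<phi>: "\<phi> z = z * (ex_B z)\<^sup>2 / (1 - z)" if "z \<in> ball 0 1" for z
    using assms(2)[OF that] is_pair_ex_b[OF assms(1) that] ex_b_div_ex_a[OF that] by simp
  have "(\<lambda>z. z * (ex_B z)\<^sup>2 / (1 - z)) holomorphic_on ball 0 1"
    using holomorphic_on_subset[OF ex_B_holomorphic ball_subset_slit_plane]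
    by (intro holomorphic_intros) auto
  then have hol: "\<phi> holomorphic_on ball 0 1"
    by (rule holomorphic_transform) (simp add: \<phi>)
  define \<psi> where "\<psi> x = x * (Re (ex_B (of_real x)))\<^sup>2 / (1 - x)" for x
  have \<phi>_real: "\<phi> (of_real x) = of_real (\<psi> x)" if "0 \<le> x" "x < 1" for x
  proof -
    have "ex_B (of_real x) = of_real (Re (ex_B (of_real x)))"
      using ex_B_of_real[OF that] by (simp add: complex_is_Real_iff complex_eq_iff)
    then have "\<phi> (of_real x) = of_real x * (of_real (Re (ex_B (of_real x))))\<^sup>2 / (1 - of_real x)"
      using \<phi>[of "of_real x"] that by simp
    then show ?thesis by (simp add: \<psi>_def)
  qed
  \<comment> \<open>Conjugating coefficients conjugates the value at a real point, and phi is real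
    there.\<close>
  have g_sum: "(\<Sum>j. g j * of_real x ^ j) = of_real (\<psi> x)" if "0 \<le> x" "x < 1" for x
  proof -
    have "(\<lambda>j. taylor_coeff \<phi> j * of_real x ^ j) sums \<phi> (of_real x)"
      using that by (intro taylor_coeff_sums hol) simp
    then have "(\<lambda>j. cnj (taylor_coeff \<phi> j * of_real x ^ j)) sums cnj (\<phi> (of_real x))"
      by (simp only: sums_cnj)
    then show ?thesis using that by (simp add: \<phi>_real g_def sums_iff)
  qed
  have \<psi>_nonneg: "0 \<le> \<psi> x" if "0 \<le> x" "x < 1" for x
    using that by (simp add: \<psi>_def)
  have lower: "1 / 2 ^ Suc N * \<psi> (ex_w (Suc N) * r) \<le> C" if r: "0 \<le> r" "r < 1" for N r
  proof -
    have wr: "0 \<le> ex_w (Suc n) * r" "ex_w (Suc n) * r < 1" for n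
    proof -
      show "0 \<le> ex_w (Suc n) * r" using ex_w_bounds[of "Suc n"] r by simp
      have "ex_w (Suc n) * r \<le> 1 * r" using ex_w_bounds(2)[of "Suc n"] r by (intro mult_right_mono) auto
      then show "ex_w (Suc n) * r < 1" using r by simp
    qed
    have sm: "summable (\<lambda>j. norm (g j) * norm (complex_of_real r) ^ j)"
      using summable_norm_taylor_coeff[OF hol r] r by (simp add: g_def)
    have summand: "(1 / 2 ^ Suc n) * (\<Sum>j. g j * (of_real (ex_w (Suc n)) * of_real r) ^ j)
        = complex_of_real (1 / 2 ^ Suc n * \<psi> (ex_w (Suc n) * r))" for n
      using g_sum[OF wr[of n]] by simp
    have "summable (\<lambda>n. complex_of_real (1 / 2 ^ Suc n * \<psi> (ex_w (Suc n) * r)))"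
      using sum_swap_test_coeff(2)[OF sm] unfolding summand .
    then have s: "summable (\<lambda>n. 1 / 2 ^ Suc n * \<psi> (ex_w (Suc n) * r))"
      by (simp only: summable_complex_of_real)
    have "1 / 2 ^ Suc N * \<psi> (ex_w (Suc N) * r) = (\<Sum>n\<in>{N}. 1 / 2 ^ Suc n * \<psi> (ex_w (Suc n) * r))" by simp
    also have "\<dots> \<le> (\<Sum>n. 1 / 2 ^ Suc n * \<psi> (ex_w (Suc n) * r))"
      using \<psi>_nonneg[OF wr] by (intro sum_le_suminf s) auto
    also have "\<dots> \<le> norm (complex_of_real (\<Sum>n. 1 / 2 ^ Suc n * \<psi> (ex_w (Suc n) * r)))"
      by simp
    also have "complex_of_real (\<Sum>n. 1 / 2 ^ Suc n * \<psi> (ex_w (Suc n) * r)) =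
        (\<Sum>j. test_coeff j * g j * of_real r ^ j)"
      using sum_swap_test_coeff(1)[OF sm] unfolding summand sums_iff suminf_of_real[OF s] by simp
    also have "norm \<dots> \<le> C" using C[OF r] .
    finally show ?thesis .
  qed
  \<comment> \<open>2916 = 2 * 2 * 27^2: one 2 from x \<ge> 1/2, the other from 1 - x = 2/p^2, and
    27^2 from the bound on the squared Blaschke product. With p = 2^(N+1) the value p^2/2916 meets
    the weight 1/p.\<close>
  have growth: "2 ^ Suc N / 2916 \<le> C" for N
  proof -
    let ?x = "test_point N"
    define p :: real where "p = 2 ^ Suc N"
    have p4: "4 ^ Suc N = p\<^sup>2" unfolding p_def by (simp add: power2_eq_square flip: power_mult_distrib)
    have p0: "p > 0" by (simp add: p_def)
    have w0: "0 < ex_w (Suc N)" by (rule ex_w_bounds) simp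
    \<comment> \<open>The radius is x / w with w = \<open>ex_w (Suc N)\<close>; it is below 1
      because the test point lies to the left of this zero.\<close>
    have "1 / 2 ^ Suc N * \<psi> (ex_w (Suc N) * (?x / ex_w (Suc N))) \<le> C"
      by (rule lower) (use test_point_bounds[of N] w0 in auto)
    then have le: "1 / p * \<psi> ?x \<le> C" using w0 by (simp add: p_def)
    have x1: "?x < 1" using test_point_bounds[of N] ex_w_bounds[of "Suc N"] by linarith
    have "(2::real) ^ 1 \<le> 2 ^ Suc N" by (intro power_increasing) auto
    then have "4 \<le> p\<^sup>2" using power_mono[of 2 p 2] by (simp add: p_def)
    then have "2 / p\<^sup>2 \<le> 1 / 2" using p0 by (simp add: divide_le_eq)
    then have xh: "1 / 2 \<le> ?x" unfolding test_point_def p4 by simp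
    have "(1 / 27)\<^sup>2 \<le> (norm (ex_B (of_real ?x)))\<^sup>2"
      using norm_ex_B_test_point[of N] by (intro power_mono) auto
    also have "(norm (ex_B (of_real ?x)))\<^sup>2 = (Re (ex_B (of_real ?x)))\<^sup>2"
      using ex_B_of_real[of ?x] test_point_bounds[of N] x1 by (simp add: cmod_power2 complex_is_Real_iff)
    finally have "1 / 2 * (1 / 27)\<^sup>2 / (1 - ?x) \<le> \<psi> ?x"
      unfolding \<psi>_def using xh x1 by (intro divide_right_mono mult_mono) auto
    moreover have "1 - ?x = 2 / p\<^sup>2" unfolding test_point_def p4 by simp
    ultimately have "p\<^sup>2 / 2916 \<le> \<psi> ?x" by (simp add: power2_eq_square)
    then have "1 / p * (p\<^sup>2 / 2916) \<le> 1 / p * \<psi> ?x" using p0 by (intro mult_left_mono) auto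
    moreover have "1 / p * (p\<^sup>2 / 2916) = p / 2916" using p0 by (simp add: power2_eq_square)
    ultimately have "p / 2916 \<le> C" using le by linarith
    then show ?thesis unfolding p_def .
  qed
  obtain N where "2916 * C < 2 ^ N" using real_arch_pow[of 2 "2916 * C"] by auto
  moreover have "(2::real) ^ N \<le> 2 ^ Suc N" by simp
  ultimately show False using growth[of N] by linarith
qed

end
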